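(* Let $f\colon \mathbb{D}\to\mathbb{D}$ be a hyperbolic inner function with Denjoy--Wolff point $p\in\partial\mathbb{D}$, and let $\alpha=f'(p)\in(0,1)$ be its angular derivative at $p$. Then for every $\varepsilon$ with $0<\varepsilon<1$, for $\lambda$-almost every $\zeta\in\partial\mathbb{D}$ there exists $N\in\mathbb{N}$ (depending on $\zeta$ and $\varepsilon$) such that for all $n\ge N$, $$(f^* )^n(\zeta)\in A\bigl(p;\alpha^{(1+\varepsilon)n},\alpha^{(1-\varepsilon)n}\bigr)\cap\partial\mathbb{D}.$$
   Context: $\mathbb{D}$ is the open unit disk in $\mathbb{C}$, $\partial\mathbb{D}$ the unit circle, and $\lambda$ the normalized Lebesgue measure on $\partial\mathbb{D}$. For $p\in\mathbb{C}$ and $0\le a<b$, $A(p;a,b)=\{z\in\mathbb{C}: a<|z-p|<b\}$. An inner function is a holomorphic map $f\colon\mathbb{D}\to\mathbb{D}$ such that for $\lambda$-almost every $\zeta\in\partial\mathbb{D}$ the radial limit $f^*(\zeta)=\lim_{r\to1^-}f(r\zeta)$ exists and belongs to $\partial\mathbb{D}$. The radial extension $f^*\colon\partial\mathbb{D}\to\partial\mathbb{D}$ is defined $\lambda$-almost everywhere, and its iterates $(f^* )^n$ are also defined $\lambda$-almost everywhere. The Denjoy--Wolff point of a holomorphic $f\colon\mathbb{D}\to\mathbb{D}$ (not conjugate to a rotation) is the unique point $p\in\overline{\mathbb{D}}$ such that $f^n(z)\to p$ as $n\to\infty$ for every $z\in\mathbb{D}$, where $f^n$ is the $n$-th iterate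 of $f$. A Stolz angle at $a\in\partial\mathbb{D}$ is a region $\Delta=\{z\in\mathbb{D}: |\arg(1-\overline{a}z)|<\beta,\ |z-a|<\rho\}$ with $0<\beta<\pi/2$ and $0<\rho<2\cos\beta$. A holomorphic $f\colon\mathbb{D}\to\mathbb{C}$ has angular limit $f(a)=b$ at $a\in\partial\mathbb{D}$ if $\lim_{z\to a,\,z\in\Delta}f(z)=b$ for every Stolz angle $\Delta$ at $a$. It has angular derivative $f'(a)=b\in\mathbb{C}\cup\{\infty\}$ at $a$ if the angular limit $f(a)\neq\infty$ exists and $\lim_{z\to a,\,z\in\Delta}\frac{f(z)-f(a)}{z-a}=b$ for every Stolz angle $\Delta$ at $a$. If $f\colon\mathbb{D}\to\mathbb{D}$ is holomorphic with Denjoy--Wolff point $p\in\partial\mathbb{D}$, then $f'(p)$ exists and $0<f'(p)\le 1$; $f$ is called hyperbolic if $f'(p)\in(0,1)$. No holomorphic extension of $f$ to a neighbourhood of $p$ is assumed. *)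

theory Defs
  imports "HOL-Complex_Analysis.Complex_Analysis"
begin

definition circle_measure :: "complex measure" where
  "circle_measure =
     distr (uniform_measure lborel {0..<2 * pi}) (restrict_space borel (sphere 0 1)) cis"

definition annulus :: "complex \<Rightarrow> real \<Rightarrow> real \<Rightarrow> complex set" where
  "annulus p a b = {z. a < norm (z - p) \<and> norm (z - p) < b}"

definition has_radial_limit :: "(complex \<Rightarrow> complex) \<Rightarrow> complex \<Rightarrow> complex \<Rightarrow> bool" where
  "has_radial_limit f \<zeta> w \<longleftrightarrow> ((\<lambda>r. f (complex_of_real r * \<zeta>)) \<longlongrightarrow> w) (at_left 1)"

definition inner_function :: "(complex \<Rightarrow> complex) \<Rightarrow> bool" where
  "inner_function f \<longleftrightarrow>
     f holomorphic_on ball 0 1 \<and> f ` ball 0 1 \<subseteq> ball 0 1 \<and>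
     (AE \<zeta> in circle_measure. \<exists>w\<in>sphere 0 1. has_radial_limit f \<zeta> w)"

text \<open>
  The radial extension is a partial self-map of the unit circle, undefined where the radial limit
  does not exist or is not unimodular. Its iterates are iterates of a partial map: they are
  undefined as soon as the orbit leaves the domain of the radial extension.
\<close>

definition radial_extension :: "(complex \<Rightarrow> complex) \<Rightarrow> complex \<rightharpoonup> complex" where
  "radial_extension f \<zeta> =
     (if \<zeta> \<in> sphere 0 1 \<and> (\<exists>w\<in>sphere 0 1. has_radial_limit f \<zeta> w)
      then Some (THE w. has_radial_limit f \<zeta> w) else None)"

primrec radial_iterate :: "(complex \<Rightarrow> complex) \<Rightarrow> nat \<Rightarrow> complex \<rightharpoonup> complex" where
  "radial_iterate f 0 = Some"
| "radial_iterate f (Suc n) = radial_extension f \<circ>\<^sub>m radial_iterate f n"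

definition denjoy_wolff_point :: "(complex \<Rightarrow> complex) \<Rightarrow> complex \<Rightarrow> bool" where
  "denjoy_wolff_point f p \<longleftrightarrow>
     p \<in> cball 0 1 \<and> (\<forall>z\<in>ball 0 1. (\<lambda>n. (f ^^ n) z) \<longlonglongrightarrow> p)"

definition stolz_angle :: "complex \<Rightarrow> real \<Rightarrow> real \<Rightarrow> complex set" where
  "stolz_angle a \<beta> \<rho> = {z \<in> ball 0 1. \<bar>Arg (1 - cnj a * z)\<bar> < \<beta> \<and> norm (z - a) < \<rho>}"

definition has_angular_limit :: "(complex \<Rightarrow> complex) \<Rightarrow> complex \<Rightarrow> complex \<Rightarrow> bool" where
  "has_angular_limit f a b \<longleftrightarrow>
     (\<forall>\<beta> \<rho>. 0 < \<beta> \<longrightarrow> \<beta> < pi / 2 \<longrightarrow> 0 < \<rho> \<longrightarrow> \<rho> < 2 * cos \<beta> \<longrightarrow>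
        (f \<longlongrightarrow> b) (at a within stolz_angle a \<beta> \<rho>))"

text \<open>
  Finite angular derivatives only. The boundary value \<open>c\<close> is the angular limit of \<open>f\<close> at \<open>a\<close>; the
  value of the function \<open>f\<close> at the boundary point \<open>a\<close> itself plays no role.
\<close>

definition has_angular_derivative :: "(complex \<Rightarrow> complex) \<Rightarrow> complex \<Rightarrow> complex \<Rightarrow> bool" where
  "has_angular_derivative f a b \<longleftrightarrow>
     (\<exists>c. has_angular_limit f a c \<and> has_angular_limit (\<lambda>z. (f z - c) / (z - a)) a b)"

definition hyperbolic :: "(complex \<Rightarrow> complex) \<Rightarrow> bool" where
  "hyperbolic f \<longleftrightarrow>
     (\<exists>p\<in>sphere 0 1. denjoy_wolff_point f p \<and>
        (\<exists>\<alpha>::real. 0 < \<alpha> \<and> \<alpha> < 1 \<and> has_angular_derivative f p (complex_of_real \<alpha>)))"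

lemma has_radial_limit_unique:
  "has_radial_limit f \<zeta> w \<Longrightarrow> has_radial_limit f \<zeta> w' \<Longrightarrow> w = w'"
  unfolding has_radial_limit_def by (rule tendsto_unique[OF trivial_limit_at_left_real])

lemma radial_extension_eq_Some_iff:
  "radial_extension f \<zeta> = Some w \<longleftrightarrow>
     \<zeta> \<in> sphere 0 1 \<and> w \<in> sphere 0 1 \<and> has_radial_limit f \<zeta> w"
proof -
  have "(THE w. has_radial_limit f \<zeta> w) = v" if "has_radial_limit f \<zeta> v" for v
    using that has_radial_limit_unique by blast
  then show ?thesis
    unfolding radial_extension_def by auto
qed

lemma cis_measurable_circle:
  "cis \<in> uniform_measure lborel {0..<2 * pi} \<rightarrow>\<^sub>M restrict_space borel (sphere 0 1)"
proof -
  have "cis \<in> borel_measurable borel"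
    by (intro borel_measurable_continuous_onI continuous_intros)
  then show ?thesis
    by (auto simp: measurable_restrict_space2_iff)
qed

lemma emeasure_circle_measure_sphere: "emeasure circle_measure (sphere 0 1) = 1"
proof -
  have "cis -` sphere 0 1 = UNIV" by auto
  then show ?thesis
    unfolding circle_measure_def
    by (subst emeasure_distr[OF cis_measurable_circle])
       (auto simp: sets_restrict_space emeasure_uniform_measure ennreal_divide_self)
qed

end

(*
Write z_n = f^n(0) and let omega_z be the harmonic measure of the disc seen from z. An inner
function satisfies (f* )_* omega_z = omega_(f z): both measures have the same moments. Hence
(f* )^n carries Lebesgue measure omega_0 to omega_(z_n). Integrating the holomorphic functions
(1 + delta - cnj p * w)^(1/2) and (1 + eta - cnj p * w)^(-1/2), whose real parts are comparable to
their moduli, gives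
  omega_z (|w - p| >= d) <= 2 (|z - p| / d)^(1/2),   omega_z (|w - p| <= eta) <= 2 (eta / |z - p|)^(1/2).

It remains to see that |z_n - p|^(1/n) tends to alpha. In the half-plane picture
w_n = (p + z_n) / (p - z_n), Julia's lemma makes Re w_n grow by a factor of at least 1/alpha at each
step, while by Schwarz--Pick the Euclidean size of a step is at most a constant times Re w_n. Summing
a geometric series, |Im w_n| <= C Re w_n, so the orbit stays in a Stolz angle and
(z_(n+1) - p) / (z_n - p) tends to the angular derivative alpha. The two tail probabilities at
radii alpha^((1 -+ epsilon) n) are therefore O(alpha^(epsilon n / 4)), and Borel--Cantelli applies.
*)
theory Submission
  imports Defs
begin

section \<open>Julia's lemma and the Denjoy--Wolff point\<close>

text \<open>This identity turns contraction of the pseudo-hyperbolic distance into a comparison of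
  the defects \<open>1 - |.|^2\<close>, the form in which Schwarz-Pick survives passage to the
  boundary.\<close>

lemma norm_one_minus_cnj_mult_sq:
  fixes a z :: complex
  shows "(norm (1 - cnj a * z))\<^sup>2 - (norm (z - a))\<^sup>2 = (1 - (norm a)\<^sup>2) * (1 - (norm z)\<^sup>2)"
  unfolding cmod_power2 by (simp add: power2_eq_square algebra_simps)

lemma norm_one_minus_cnj_mult_pos:
  fixes a z :: complex
  assumes "norm a < 1" "norm z \<le> 1"
  shows "norm (1 - cnj a * z) > 0"
proof -
  have "norm (cnj a * z) \<le> norm a"
    using assms by (simp add: norm_mult mult_left_le)
  with assms show ?thesis by auto
qed

text \<open>Conjugating \<open>f\<close> by the disc automorphisms that move \<open>a\<close> and
  \<open>f a\<close> to 0 reduces this to the Schwarz lemma. The cross-multiplied form spares later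
  arguments the denominators.\<close>

lemma schwarz_pick:
  assumes holo: "f holomorphic_on ball 0 1" and im: "f ` ball 0 1 \<subseteq> ball 0 1"
    and a: "a \<in> ball 0 1" and z: "z \<in> ball 0 1"
  shows "norm (f z - f a) * norm (1 - cnj a * z) \<le> norm (z - a) * norm (1 - cnj (f a) * f z)"
proof -
  have fa: "norm (f a) < 1" and fz: "norm (f z) < 1" using im a z by (auto simp: image_subset_iff)
  define h where "h = (\<lambda>x. Moebius_function 0 (f a) (f (Moebius_function 0 (- a) x)))"
  have M: "Moebius_function 0 (- a) ` ball 0 1 \<subseteq> ball 0 1"
    using Moebius_function_norm_lt_1[of "- a"] a by auto
  have "Moebius_function 0 (- a) holomorphic_on ball 0 1"
    using a by (intro Moebius_function_holomorphic) auto
  then have "(f \<circ> Moebius_function 0 (- a)) holomorphic_on ball 0 1"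
    by (rule holomorphic_on_compose_gen[OF _ holo M])
  then have hh: "h holomorphic_on ball 0 1"
    unfolding h_def using im M
    by (auto intro!: holomorphic_on_compose_gen[unfolded o_def, OF _ Moebius_function_holomorphic[OF fa]]
        simp: o_def image_subset_iff)
  have h0: "h 0 = 0"
    by (simp add: h_def Moebius_function_of_zero Moebius_function_eq_zero)
  have hn: "norm (h x) < 1" if "norm x < 1" for x
    unfolding h_def using that im M fa
    by (intro Moebius_function_norm_lt_1) (auto simp: image_subset_iff)
  define x where "x = Moebius_function 0 a z"
  have x: "norm x < 1"
    unfolding x_def using a z by (intro Moebius_function_norm_lt_1) auto
  have "Moebius_function 0 (- a) x = z"
    unfolding x_def using a z by (intro Moebius_function_compose) auto
  then have "h x = (f z - f a) / (1 - cnj (f a) * f z)"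
    by (simp add: h_def Moebius_function_simple)
  moreover have "norm (h x) \<le> norm x"
    using Schwarz_Lemma(1)[OF hh h0 hn x] by simp
  ultimately have "norm (f z - f a) / norm (1 - cnj (f a) * f z) \<le> norm (z - a) / norm (1 - cnj a * z)"
    by (simp add: x_def Moebius_function_simple norm_divide)
  moreover have "norm (1 - cnj (f a) * f z) > 0" "norm (1 - cnj a * z) > 0"
    using norm_one_minus_cnj_mult_pos fa fz a z by (auto simp: less_imp_le)
  ultimately show ?thesis
    by (simp add: field_simps)
qed

text \<open>Square Schwarz-Pick and rewrite both distances by
  \<open>norm_one_minus_cnj_mult_sq\<close>: the product of the two squared denominators occurs on
  both sides and cancels.\<close>

lemma schwarz_pick_sq:
  assumes holo: "f holomorphic_on ball 0 1" and im: "f ` ball 0 1 \<subseteq> ball 0 1"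
    and a: "a \<in> ball 0 1" and z: "z \<in> ball 0 1"
  shows "(norm (1 - cnj (f a) * f z))\<^sup>2 * ((1 - (norm a)\<^sup>2) * (1 - (norm z)\<^sup>2))
    \<le> (norm (1 - cnj a * z))\<^sup>2 * ((1 - (norm (f a))\<^sup>2) * (1 - (norm (f z))\<^sup>2))"
proof -
  have "(norm (f z - f a) * norm (1 - cnj a * z))\<^sup>2 \<le> (norm (z - a) * norm (1 - cnj (f a) * f z))\<^sup>2"
    by (intro power_mono schwarz_pick assms) auto
  then show ?thesis
    unfolding norm_one_minus_cnj_mult_sq[symmetric] by (simp add: power_mult_distrib algebra_simps)
qed

text \<open>The limit of \<open>schwarz_pick_sq\<close> along moving base points \<open>a n\<close>.
  Leaving the bound \<open>q\<close> on the quotient of defects open serves two purposes: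
  \<open>q = 1\<close> gives Wolff's inequality, \<open>q\<close> tending to \<open>\<alpha>\<close>
  gives Julia's lemma with the angular derivative.\<close>

lemma julia_inequality:
  assumes holo: "f holomorphic_on ball 0 1" and im: "f ` ball 0 1 \<subseteq> ball 0 1"
    and z: "z \<in> ball 0 1"
    and a: "\<And>n. a n \<in> ball 0 1" and "a \<longlonglongrightarrow> p" and "(\<lambda>n. f (a n)) \<longlonglongrightarrow> c" and "q \<longlonglongrightarrow> L"
    and q: "\<And>n. 1 - (norm (f (a n)))\<^sup>2 \<le> q n * (1 - (norm (a n))\<^sup>2)"
  shows "(norm (1 - cnj c * f z))\<^sup>2 * (1 - (norm z)\<^sup>2)
    \<le> L * ((norm (1 - cnj p * z))\<^sup>2 * (1 - (norm (f z))\<^sup>2))"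
proof (rule LIMSEQ_le)
  show "(\<lambda>n. (norm (1 - cnj (f (a n)) * f z))\<^sup>2 * (1 - (norm z)\<^sup>2))
     \<longlonglongrightarrow> (norm (1 - cnj c * f z))\<^sup>2 * (1 - (norm z)\<^sup>2)"
    by (intro tendsto_intros assms)
  show "(\<lambda>n. q n * ((norm (1 - cnj (a n) * z))\<^sup>2 * (1 - (norm (f z))\<^sup>2)))
     \<longlonglongrightarrow> L * ((norm (1 - cnj p * z))\<^sup>2 * (1 - (norm (f z))\<^sup>2))"
    by (intro tendsto_intros assms)
  have "(norm (1 - cnj (f (a n)) * f z))\<^sup>2 * (1 - (norm z)\<^sup>2)
      \<le> q n * ((norm (1 - cnj (a n) * z))\<^sup>2 * (1 - (norm (f z))\<^sup>2))" for n
  proof -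
    have pos: "1 - (norm (a n))\<^sup>2 > 0"
      using a[of n] by (simp add: power_less_one_iff abs_square_less_1)
    have pos': "1 - (norm (f z))\<^sup>2 \<ge> 0"
      using im z by (auto simp: abs_square_le_1 image_subset_iff less_imp_le)
    have "(norm (1 - cnj (f (a n)) * f z))\<^sup>2 * ((1 - (norm (a n))\<^sup>2) * (1 - (norm z)\<^sup>2))
      \<le> (norm (1 - cnj (a n) * z))\<^sup>2 * ((1 - (norm (f (a n)))\<^sup>2) * (1 - (norm (f z))\<^sup>2))"
      by (rule schwarz_pick_sq[OF holo im a z])
    also have "\<dots> \<le> (norm (1 - cnj (a n) * z))\<^sup>2 * ((q n * (1 - (norm (a n))\<^sup>2)) * (1 - (norm (f z))\<^sup>2))"
      by (intro mult_left_mono mult_right_mono q pos') auto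
    finally have "((norm (1 - cnj (f (a n)) * f z))\<^sup>2 * (1 - (norm z)\<^sup>2)) * (1 - (norm (a n))\<^sup>2)
      \<le> (q n * ((norm (1 - cnj (a n) * z))\<^sup>2 * (1 - (norm (f z))\<^sup>2))) * (1 - (norm (a n))\<^sup>2)"
      by (simp add: algebra_simps)
    then show ?thesis using pos by (simp add: mult_le_cancel_right)
  qed
  then show "\<exists>N. \<forall>n\<ge>N. (norm (1 - cnj (f (a n)) * f z))\<^sup>2 * (1 - (norm z)\<^sup>2)
      \<le> q n * ((norm (1 - cnj (a n) * z))\<^sup>2 * (1 - (norm (f z))\<^sup>2))" by blast
qed

text \<open>A sequence strictly decreasing from index \<open>m\<close> on would have its limit at
  most \<open>r m\<close>, which lies below \<open>l\<close>.\<close>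

lemma infinitely_often_nondecreasing:
  fixes r :: "nat \<Rightarrow> real"
  assumes "r \<longlonglongrightarrow> l" and "\<And>n. r n < l"
  shows "\<exists>n\<ge>m. r n \<le> r (Suc n)"
proof (rule ccontr)
  assume "\<not> ?thesis"
  then have *: "r (Suc n) < r n" if "n \<ge> m" for n using that by (meson not_le)
  have "r n \<le> r m" if "n \<ge> m" for n
    using that by (induction rule: dec_induct) (auto dest: * intro: order_trans less_imp_le)
  then have "l \<le> r m"
    using assms(1) by (intro LIMSEQ_le_const2) auto
  with assms(2)[of m] show False by simp
qed

text \<open>Wolff's lemma: \<open>f\<close> maps each horodisc at \<open>p\<close> into itself. The
  base points come from the orbit of 0, so it is available before any boundary value of
  \<open>f\<close> at \<open>p\<close> has been identified.\<close>

lemma wolff_inequality: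
  assumes holo: "f holomorphic_on ball 0 1" and im: "f ` ball 0 1 \<subseteq> ball 0 1"
    and z: "z \<in> ball 0 1" and p: "p \<in> sphere 0 1" and dw: "denjoy_wolff_point f p"
  shows "(norm (1 - cnj p * f z))\<^sup>2 * (1 - (norm z)\<^sup>2) \<le> (norm (1 - cnj p * z))\<^sup>2 * (1 - (norm (f z))\<^sup>2)"
proof -
  define Z where "Z = (\<lambda>n. (f ^^ n) 0)"
  have Zb: "Z n \<in> ball 0 1" for n
    by (induction n) (use im in \<open>auto simp: Z_def image_subset_iff\<close>)
  have Zp: "Z \<longlonglongrightarrow> p"
    using dw by (auto simp: Z_def denjoy_wolff_point_def)
  have "(\<lambda>n. norm (Z n)) \<longlonglongrightarrow> 1"
    using tendsto_norm[OF Zp] p by simp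
  \<comment> \<open>Along times at which the orbit does not move away from the circle, the quotient
    \<open>(1 - |f a|\<^sup>2) / (1 - |a|\<^sup>2)\<close> in Julia's inequality is at most \<open>1\<close>.\<close>
  then have "\<forall>m. \<exists>n\<ge>m. norm (Z n) \<le> norm (Z (Suc n))"
    using Zb by (intro allI infinitely_often_nondecreasing) auto
  then obtain s where s: "\<And>m. s m \<ge> m" "\<And>m. norm (Z (s m)) \<le> norm (Z (Suc (s m)))"
    by metis
  \<comment> \<open>The chosen times may fail to be monotone, but \<open>s m \<ge> m\<close> already
    lets limits be taken along them.\<close>
  have sl: "filterlim s at_top sequentially"
    by (rule filterlim_at_top_mono[OF filterlim_ident]) (simp add: s)
  have "(\<lambda>n. Z (s n)) \<longlonglongrightarrow> p" "(\<lambda>n. Z (Suc (s n))) \<longlonglongrightarrow> p"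
    using filterlim_compose[OF Zp sl] filterlim_compose[OF LIMSEQ_Suc[OF Zp] sl] by auto
  moreover have "1 - (norm (f (Z (s n))))\<^sup>2 \<le> 1 * (1 - (norm (Z (s n)))\<^sup>2)" for n
    using s(2)[of n] by (simp add: Z_def power_mono)
  ultimately show ?thesis
    using julia_inequality[OF holo im z, of "\<lambda>n. Z (s n)" p p "\<lambda>_. 1" 1] Zb by (simp add: Z_def)
qed

section \<open>Angular limits along sequences\<close>

lemma eventually_stolz_radius:
  assumes p: "p \<in> sphere 0 1" and s: "s \<longlonglongrightarrow> 1" and s1: "\<And>n::nat. 0 < s n \<and> s n < (1::real)"
    and \<beta>: "0 < \<beta>" "\<beta> < pi / 2" and \<rho>: "0 < \<rho>"
  shows "\<forall>\<^sub>F n in sequentially. of_real (s n) * p \<in> stolz_angle p \<beta> \<rho>"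
proof -
  have "\<forall>\<^sub>F n in sequentially. dist (s n) 1 < \<rho>"
    using s \<rho> by (rule tendstoD)
  then show ?thesis
  proof eventually_elim
    case (elim n)
    have pp: "cnj p * p = 1" using p by (simp add: complex_norm_square[symmetric] mult.commute)
    have "1 - cnj p * (of_real (s n) * p) = of_real (1 - s n)"
      using pp by (simp add: algebra_simps)
    then have "Arg (1 - cnj p * (of_real (s n) * p)) = 0"
      using s1[of n] by (simp only: Arg_of_real) simp
    moreover have "of_real (s n) * p - p = of_real (s n - 1) * p" by (simp add: algebra_simps)
    then have "norm (of_real (s n) * p - p) = 1 - s n"
      using s1[of n] p by (simp add: norm_mult del: of_real_diff)
    ultimately show ?case
      using elim s1[of n] p \<beta> by (simp add: stolz_angle_def norm_mult dist_real_def)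
  qed
qed

lemma angular_limit_sequence:
  assumes lim: "has_angular_limit g a b"
    and \<beta>: "0 < \<beta>" "\<beta> < pi / 2" "0 < \<rho>" "\<rho> < 2 * cos \<beta>"
    and Z: "Z \<longlonglongrightarrow> a" "\<forall>\<^sub>F n in sequentially. Z n \<in> stolz_angle a \<beta> \<rho>" and a: "a \<in> sphere 0 1"
  shows "(\<lambda>n. g (Z n)) \<longlonglongrightarrow> b"
proof -
  have "(g \<longlongrightarrow> b) (at a within stolz_angle a \<beta> \<rho>)"
    using lim \<beta> by (auto simp: has_angular_limit_def)
  moreover have "filterlim Z (at a within stolz_angle a \<beta> \<rho>) sequentially"
    unfolding filterlim_at using Z(1)
    by (auto intro!: eventually_mono[OF Z(2)] simp: stolz_angle_def) (use a in auto)
  ultimately show ?thesis by (rule filterlim_compose)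
qed

text \<open>The double \<open>Suc\<close> makes the first term 1/2, so every term lies strictly
  between 0 and 1. A sequence, in place of the filter \<open>at_left 1\<close>, is what
  measurability and dominated convergence work with later.\<close>

lemma radial_sequence:
  defines "s \<equiv> \<lambda>n::nat. 1 - inverse (real (Suc (Suc n)))"
  shows "s \<longlonglongrightarrow> 1" "0 < s n \<and> s n < 1" "filterlim s (at_left 1) sequentially"
proof -
  have "(\<lambda>n. inverse (real (Suc n))) \<longlonglongrightarrow> 0" by (rule LIMSEQ_inverse_real_of_nat)
  then have "(\<lambda>n. inverse (real (Suc (Suc n)))) \<longlonglongrightarrow> 0" by (rule LIMSEQ_Suc)
  from tendsto_diff[OF tendsto_const this, of 1] show 1: "s \<longlonglongrightarrow> 1" by (simp add: s_def)
  show 2: "0 < s n \<and> s n < 1" for n by (auto simp: s_def field_simps)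
  show "filterlim s (at_left 1) sequentially"
    unfolding filterlim_at using 1 2 by (auto simp: less_imp_neq)
qed

lemma angular_limit_radial_sequence:
  assumes "has_angular_limit g p b" and p: "p \<in> sphere 0 1"
  shows "(\<lambda>n. g (of_real (1 - inverse (real (Suc (Suc n)))) * p)) \<longlonglongrightarrow> b"
\<comment> \<open>Radial points lie in Stolz angles of every opening; for \<open>pi / 3\<close> the
  bound \<open>2 * cos (pi / 3)\<close> is 1, so the radius 1/2 is admissible.\<close>
proof (rule angular_limit_sequence[OF assms(1), of "pi/3" "1/2"])
  show "(\<lambda>n. of_real (1 - inverse (real (Suc (Suc n)))) * p) \<longlonglongrightarrow> p"
  proof -
    have "(\<lambda>n. of_real (1 - inverse (real (Suc (Suc n)))) * p) \<longlonglongrightarrow> of_real 1 * p"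
      by (intro tendsto_mult tendsto_of_real tendsto_const radial_sequence(1))
    then show ?thesis by simp
  qed
  show "\<forall>\<^sub>F n in sequentially. of_real (1 - inverse (real (Suc (Suc n)))) * p \<in> stolz_angle p (pi / 3) (1 / 2)"
    using radial_sequence by (intro eventually_stolz_radius p) auto
qed (use p in \<open>auto simp: cos_60\<close>)

lemma norm_one_minus_cnj_eq_dist:
  assumes "p \<in> sphere 0 1"
  shows "norm (1 - cnj p * z) = norm (p - z)"
proof -
  have "cnj p * p = 1" using assms by (simp add: complex_norm_square[symmetric] mult.commute)
  then have "1 - cnj p * z = cnj p * (p - z)" by (simp add: algebra_simps)
  then show ?thesis using assms by (simp add: norm_mult)
qed

text \<open>Wolff's inequality at the radial point \<open>s p\<close> gives
  \<open>|p - f (s p)|^2 \<le> 1 - s\<close>, so the radial limit of \<open>f\<close> at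
  \<open>p\<close>, hence the angular one, can only be \<open>p\<close>.\<close>

lemma wolff_angular_limit:
  assumes holo: "f holomorphic_on ball 0 1" and im: "f ` ball 0 1 \<subseteq> ball 0 1"
    and p: "p \<in> sphere 0 1" and dw: "denjoy_wolff_point f p" and c: "has_angular_limit f p c"
  shows "c = p"
proof -
  define s where "s n = 1 - inverse (real (Suc (Suc n)))" for n
  define a where "a n = of_real (s n) * p" for n
  have s: "s \<longlonglongrightarrow> 1" "0 < s n" "s n < 1" for n
    unfolding s_def using radial_sequence by blast+
  have lim: "(\<lambda>n. f (a n)) \<longlonglongrightarrow> c"
    unfolding a_def s_def using angular_limit_radial_sequence[OF c p] .
  have ab: "a n \<in> ball 0 1" for n using s(2,3)[of n] p by (simp add: a_def norm_mult)
  have "(norm (p - f (a n)))\<^sup>2 \<le> 1 - s n" for n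
  proof -
    have "p - a n = of_real (1 - s n) * p" by (simp add: a_def algebra_simps)
    then have na: "norm (p - a n) = 1 - s n" "norm (a n) = s n"
      using s(2,3)[of n] p by (auto simp: norm_mult a_def simp del: of_real_diff)
    have "(norm (p - f (a n)))\<^sup>2 * (1 - (s n)\<^sup>2) \<le> (1 - s n)\<^sup>2 * (1 - (norm (f (a n)))\<^sup>2)"
      using wolff_inequality[OF holo im ab[of n] p dw] by (simp only: norm_one_minus_cnj_eq_dist[OF p] na)
    also have "\<dots> \<le> (1 - s n)\<^sup>2" by (simp add: mult_left_le)
    also have "\<dots> \<le> (1 - s n) * (1 - (s n)\<^sup>2)"
      using s(2,3)[of n] by (simp add: power2_eq_square mult_left_le_one_le)
    finally show ?thesis
    proof (rule mult_right_le_imp_le)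
      show "0 < 1 - (s n)\<^sup>2" using s(2,3)[of n] by (simp add: power_less_one_iff)
    qed
  qed
  moreover have "(\<lambda>n. (norm (p - f (a n)))\<^sup>2) \<longlonglongrightarrow> (norm (p - c))\<^sup>2"
    by (intro tendsto_intros lim)
  moreover have "(\<lambda>n. 1 - s n) \<longlonglongrightarrow> 1 - 1"
    by (intro tendsto_intros s)
  ultimately have "(norm (p - c))\<^sup>2 \<le> 1 - 1"
    by (intro LIMSEQ_le) auto
  then show ?thesis by simp
qed

text \<open>Julia's lemma with base points on the radius to \<open>p\<close>: horodiscs at
  \<open>p\<close> shrink by the factor \<open>\<alpha>\<close>.\<close>

lemma julia_angular_derivative:
  assumes holo: "f holomorphic_on ball 0 1" and im: "f ` ball 0 1 \<subseteq> ball 0 1"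
    and p: "p \<in> sphere 0 1" and c: "has_angular_limit f p p"
    and d: "has_angular_limit (\<lambda>z. (f z - p) / (z - p)) p (of_real \<alpha>)" and \<alpha>: "0 < \<alpha>"
    and z: "z \<in> ball 0 1"
  shows "(norm (1 - cnj p * f z))\<^sup>2 * (1 - (norm z)\<^sup>2)
    \<le> \<alpha> * ((norm (1 - cnj p * z))\<^sup>2 * (1 - (norm (f z))\<^sup>2))"
proof -
  define s where "s n = 1 - inverse (real (Suc (Suc n)))" for n
  define a where "a n = of_real (s n) * p" for n
  have s: "s \<longlonglongrightarrow> 1" "0 < s n" "s n < 1" for n
    unfolding s_def using radial_sequence by blast+
  have lim: "(\<lambda>n. f (a n)) \<longlonglongrightarrow> p"
    unfolding a_def s_def using angular_limit_radial_sequence[OF c p] .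
  have dlim: "(\<lambda>n. (f (a n) - p) / (a n - p)) \<longlonglongrightarrow> of_real \<alpha>"
    unfolding a_def s_def using angular_limit_radial_sequence[OF d p] .
  have ap: "a \<longlonglongrightarrow> p"
  proof -
    have "(\<lambda>n. of_real (s n) * p) \<longlonglongrightarrow> of_real 1 * p" by (intro tendsto_intros s(1))
    then show ?thesis by (simp add: a_def[abs_def])
  qed
  have ab: "a n \<in> ball 0 1" for n using s(2,3)[of n] p by (simp add: a_def norm_mult)
  \<comment> \<open>The first factor dominates \<open>(1 - |f (a n)|) / (1 - |a n|)\<close>, since
    \<open>1 - |f (a n)| \<le> |f (a n) - p|\<close> and \<open>|a n - p| = 1 - |a n|\<close> on the
    radius. The second converts this to the quotient of \<open>1 - |.|^2\<close> and tends to
    1.\<close>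
  define q where "q n = norm ((f (a n) - p) / (a n - p)) * ((1 + norm (f (a n))) / (1 + norm (a n)))" for n
  have "q \<longlonglongrightarrow> norm (complex_of_real \<alpha>) * ((1 + norm p) / (1 + norm p))"
    unfolding q_def using p by (intro tendsto_intros dlim lim ap) auto
  then have q: "q \<longlonglongrightarrow> \<alpha>" using p \<alpha> by simp
  show ?thesis
  proof (rule julia_inequality[OF holo im z ab ap lim q])
    fix n
    have "p - a n = of_real (1 - s n) * p" by (simp add: a_def algebra_simps)
    then have na: "norm (a n - p) = 1 - s n" "norm (a n) = s n"
      using s(2,3)[of n] p by (auto simp: norm_mult a_def norm_minus_commute simp del: of_real_diff)
    have "1 - norm (f (a n)) \<le> norm (f (a n) - p)"
      using norm_triangle_ineq2[of p "f (a n)"] p by (simp add: norm_minus_commute)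
    then have "(1 - norm (f (a n))) * (1 + norm (f (a n))) \<le> norm (f (a n) - p) * (1 + norm (f (a n)))"
      by (intro mult_right_mono) auto
    also have "\<dots> = q n * ((1 - s n) * (1 + s n))"
      using s(2,3)[of n] by (simp add: q_def norm_divide na)
    finally show "1 - (norm (f (a n)))\<^sup>2 \<le> q n * (1 - (norm (a n))\<^sup>2)"
      unfolding na by (simp add: power2_eq_square algebra_simps)
  qed
qed

section \<open>Orbits of a hyperbolic map\<close>

text \<open>The pseudo-hyperbolic bound \<open>k < 1\<close> makes each Euclidean jump at most a
  multiple of the current real part. As real parts grow geometrically, the accumulated imaginary
  drift stays comparable to the last real part.\<close>

lemma half_plane_orbit_sector:
  fixes w :: "nat \<Rightarrow> complex"
  assumes pos: "\<And>n. Re (w n) > 0" and grow: "\<And>n. Re (w n) \<le> \<alpha> * Re (w (Suc n))"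
    and step: "\<And>n. norm (w (Suc n) - w n) \<le> k * norm (w (Suc n) + cnj (w n))"
    and \<alpha>: "0 < \<alpha>" "\<alpha> < 1" and k: "0 \<le> k" "k < 1"
  shows "\<exists>C>0. \<forall>n. \<bar>Im (w n)\<bar> \<le> C * Re (w n)"
proof -
  \<comment> \<open>Obtained by solving \<open>x \<le> k * (x + 2 * Re (w n))\<close> for the jump
    length \<open>x\<close>.\<close>
  define K where "K = 2 * k / (1 - k)"
  have K: "K \<ge> 0" using k by (simp add: K_def)
  have jump: "norm (w (Suc n) - w n) \<le> K * Re (w n)" for n
  proof -
    have "w (Suc n) + cnj (w n) = (w (Suc n) - w n) + of_real (2 * Re (w n))"
      by (simp add: complex_eq_iff)
    then have "norm (w (Suc n) + cnj (w n)) \<le> norm (w (Suc n) - w n) + norm (complex_of_real (2 * Re (w n)))"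
      by (metis norm_triangle_ineq)
    then have "norm (w (Suc n) + cnj (w n)) \<le> norm (w (Suc n) - w n) + 2 * Re (w n)"
      using pos[of n] by (simp del: of_real_mult)
    then have "k * norm (w (Suc n) + cnj (w n)) \<le> k * (norm (w (Suc n) - w n) + 2 * Re (w n))"
      using k by (intro mult_left_mono)
    with step[of n] have "norm (w (Suc n) - w n) \<le> k * (norm (w (Suc n) - w n) + 2 * Re (w n))"
      by linarith
    then show ?thesis using k by (simp add: K_def field_simps)
  qed
  \<comment> \<open>The first entry starts the induction. The second is the fixed point of
    \<open>C = (C + K) * \<alpha>\<close>, the sum of the geometric series of jumps, and makes the
    induction step close. Adding 1 makes \<open>C\<close> positive.\<close>
  define C where "C = max (\<bar>Im (w 0)\<bar> / Re (w 0)) (K * \<alpha> / (1 - \<alpha>)) + 1"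
  have "\<bar>Im (w n)\<bar> \<le> C * Re (w n)" for n
  proof (induction n)
    case 0
    have "\<bar>Im (w 0)\<bar> / Re (w 0) \<le> C" by (simp add: C_def)
    then show ?case using pos[of 0] by (simp add: divide_le_eq)
  next
    case (Suc n)
    have C0: "C \<ge> 0" using \<alpha> K by (auto simp: C_def le_max_iff_disj add_nonneg_nonneg)
    have "K * \<alpha> / (1 - \<alpha>) \<le> C" by (simp add: C_def)
    then have CK: "(C + K) * \<alpha> \<le> C" using \<alpha> by (simp add: divide_le_eq algebra_simps)
    have "\<bar>Im (w (Suc n))\<bar> \<le> \<bar>Im (w n)\<bar> + \<bar>Im (w (Suc n) - w n)\<bar>" by simp
    also have "\<dots> \<le> C * Re (w n) + K * Re (w n)"
      using Suc.IH jump[of n] abs_Im_le_cmod[of "w (Suc n) - w n"] by linarith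
    also have "\<dots> \<le> (C + K) * (\<alpha> * Re (w (Suc n)))"
      using C0 K grow[of n] by (simp add: distrib_right[symmetric] mult_left_mono)
    also have "\<dots> = ((C + K) * \<alpha>) * Re (w (Suc n))" by simp
    also have "\<dots> \<le> C * Re (w (Suc n))"
      using CK pos[of "Suc n"] by (intro mult_right_mono) auto
    finally show ?case .
  qed
  moreover have "C > 0" using K \<alpha> by (auto simp: C_def less_max_iff_disj add_nonneg_pos le_max_iff_disj)
  ultimately show ?thesis by blast
qed

text \<open>For unimodular \<open>p\<close> this is the Cayley transform of the disc onto the right
  half-plane that sends \<open>p\<close> to infinity.\<close>

definition half_plane_map :: "complex \<Rightarrow> complex \<Rightarrow> complex" where
  "half_plane_map p z = (p + z) / (p - z)"

context
  fixes p :: complex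
  assumes p: "p \<in> sphere 0 1"
begin

text \<open>The right-hand side is the Poisson kernel at the boundary point \<open>p\<close>, whose
  level sets are horocycles; Julia's lemma thereby becomes linear in the real part.\<close>

lemma Re_half_plane_map:
  assumes "z \<noteq> p"
  shows "Re (half_plane_map p z) = (1 - (norm z)\<^sup>2) / (norm (p - z))\<^sup>2"
proof -
  have "Re ((p + z) / (p - z)) = Re ((p + z) * cnj (p - z)) / (norm (p - z))\<^sup>2"
    by (simp add: complex_div_cnj[of "p + z"])
  also have "Re ((p + z) * cnj (p - z)) = (norm p)\<^sup>2 - (norm z)\<^sup>2"
    unfolding cmod_power2 by (simp add: algebra_simps power2_eq_square)
  finally show ?thesis using p by (simp add: half_plane_map_def)
qed

text \<open>The Cayley transform is an isometry between the pseudo-hyperbolic distances of disc and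
  half-plane; this carries over a bound by \<open>k\<close>.\<close>

lemma half_plane_map_step:
  assumes a: "a \<in> ball 0 1" and z: "z \<in> ball 0 1"
    and le: "norm (z - a) \<le> k * norm (1 - cnj a * z)"
  shows "norm (half_plane_map p z - half_plane_map p a)
    \<le> k * norm (half_plane_map p z + cnj (half_plane_map p a))"
proof -
  have ne: "p - z \<noteq> 0" "p - a \<noteq> 0" using a z p by auto
  have pp: "p * cnj p = 1" using p by (simp add: complex_norm_square[symmetric])
  have p0: "p \<noteq> 0" using p by auto
  with pp have cp: "cnj p = 1 / p" by (simp add: eq_divide_eq mult.commute)
  have ne': "1 - p * cnj a \<noteq> 0"
  proof
    assume "1 - p * cnj a = 0"
    then have "norm (p * cnj a) = 1" by simp
    then show False using a p by (simp add: norm_mult)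
  qed
  have n: "norm (1 - p * cnj a) = norm (p - a)"
    using norm_one_minus_cnj_eq_dist[OF p, of a] by (metis complex_cnj_cnj complex_cnj_diff complex_cnj_mult complex_cnj_one complex_mod_cnj)
  have 1: "half_plane_map p z - half_plane_map p a = 2 * p * (z - a) / ((p - z) * (p - a))"
    unfolding half_plane_map_def using ne by (simp add: field_simps)
  have ca: "cnj (half_plane_map p a) = (1 + p * cnj a) / (1 - p * cnj a)"
  proof -
    have "cnj (half_plane_map p a) = (1 / p + cnj a) / (1 / p - cnj a)"
      unfolding half_plane_map_def by (simp add: cp)
    also have "\<dots> = (p * (1 / p + cnj a)) / (p * (1 / p - cnj a))"
      using p0 by simp
    finally show ?thesis using p0 by (simp add: algebra_simps)
  qed
  have 2: "half_plane_map p z + cnj (half_plane_map p a) = 2 * p * (1 - cnj a * z) / ((p - z) * (1 - p * cnj a))"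
    unfolding ca unfolding half_plane_map_def using ne ne'
    by (simp add: divide_simps) (simp add: algebra_simps)
  have "norm (half_plane_map p z - half_plane_map p a) = 2 / (norm (p - z) * norm (p - a)) * norm (z - a)"
    unfolding 1 using p by (simp add: norm_mult norm_divide)
  also have "\<dots> \<le> 2 / (norm (p - z) * norm (p - a)) * (k * norm (1 - cnj a * z))"
    by (intro mult_left_mono le) auto
  also have "\<dots> = k * norm (half_plane_map p z + cnj (half_plane_map p a))"
    unfolding 2 using p by (simp add: norm_mult norm_divide n)
  finally show ?thesis .
qed

text \<open>With \<open>w\<close> the half-plane image of \<open>z\<close>,
  \<open>1 - cnj p * z = 2 / (w + 1)\<close>, so its argument is minus that of \<open>w + 1\<close>,
  and the shift by 1 only narrows the sector. Taking \<open>C + 1\<close> in place of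
  \<open>C\<close> gives the strict bound on the argument.\<close>

lemma half_plane_sector_stolz:
  assumes z: "z \<in> ball 0 1" and C: "\<bar>Im (half_plane_map p z)\<bar> \<le> C * Re (half_plane_map p z)" "0 < C"
    and "norm (z - p) < \<rho>"
  shows "z \<in> stolz_angle p (arctan (C + 1)) \<rho>"
proof -
  define w where "w = half_plane_map p z"
  have ne: "p - z \<noteq> 0" using z p by auto
  have pp: "cnj p * p = 1" using p by (simp add: complex_norm_square[symmetric] mult.commute)
  have w0: "Re w > 0"
    unfolding w_def using z ne
    by (subst Re_half_plane_map) (auto intro!: divide_pos_pos simp: power_less_one_iff abs_square_less_1)
  have "cnj p * (p - z) * (w + 1) = 2 * (cnj p * p)"
    unfolding w_def half_plane_map_def using ne by (simp add: field_simps)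
  then have e: "(1 - cnj p * z) * (w + 1) = 2"
    using pp by (simp add: right_diff_distrib)
  have w1: "w + 1 \<noteq> 0" using w0 by (auto simp: complex_eq_iff)
  define v where "v = 1 - cnj p * z"
  have "v = 2 / (w + 1)" using e w1 by (simp add: v_def eq_divide_eq)
  then have v: "v = of_real (2 / (norm (w + 1))\<^sup>2) * cnj (w + 1)"
    by (subst (asm) complex_div_cnj) simp
  define t where "t = 2 / (norm (w + 1))\<^sup>2"
  have t: "t > 0" using w1 by (simp add: t_def)
  have vRe: "Re v = t * (Re w + 1)" and vIm: "Im v = - (t * Im w)"
    unfolding v by (simp_all add: t_def)
  have "\<bar>Im v / Re v\<bar> = \<bar>Im w\<bar> / (Re w + 1)"
    using t w0 by (simp add: vRe vIm abs_mult)
  also have "\<dots> \<le> C"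
  proof -
    have "\<bar>Im w\<bar> \<le> C * (Re w + 1)" using C by (simp add: w_def algebra_simps)
    then show ?thesis using w0 by (simp add: divide_le_eq)
  qed
  finally have "\<bar>Im v / Re v\<bar> \<le> C" .
  then have "\<bar>Im v / Re v\<bar> < C + 1" by simp
  then have "arctan (Im v / Re v) < arctan (C + 1)" "arctan (- (C + 1)) < arctan (Im v / Re v)"
    by (auto simp only: arctan_less_iff abs_less_iff)
  moreover have "Arg v = arctan (Im v / Re v)"
    using t w0 by (intro arg_conv_arctan) (simp add: vRe)
  ultimately have "\<bar>Arg v\<bar> < arctan (C + 1)" unfolding abs_less_iff arctan_minus by linarith
  with assms show ?thesis by (simp add: stolz_angle_def v_def)
qed

end

text \<open>By Schwarz-Pick the pseudo-hyperbolic length of the orbit steps does not increase, and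
  the first step, from 0 to \<open>f 0\<close>, has length \<open>|f 0|\<close>.\<close>

lemma schwarz_pick_orbit_step:
  assumes holo: "f holomorphic_on ball 0 1" and im: "f ` ball 0 1 \<subseteq> ball 0 1"
  defines "Z \<equiv> \<lambda>n. (f ^^ n) (0::complex)"
  shows "norm (Z (Suc n) - Z n) \<le> norm (f 0) * norm (1 - cnj (Z n) * Z (Suc n))"
proof (induction n)
  case 0
  then show ?case by (simp add: Z_def)
next
  case (Suc n)
  have Zb: "Z n \<in> ball 0 1" for n
    by (induction n) (use im in \<open>auto simp: Z_def image_subset_iff\<close>)
  have "norm (Z (Suc (Suc n)) - Z (Suc n)) * norm (1 - cnj (Z n) * Z (Suc n))
      \<le> norm (Z (Suc n) - Z n) * norm (1 - cnj (Z (Suc n)) * Z (Suc (Suc n)))"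
    using schwarz_pick[OF holo im Zb[of n] Zb[of "Suc n"]] by (simp add: Z_def)
  also have "\<dots> \<le> norm (f 0) * norm (1 - cnj (Z n) * Z (Suc n)) * norm (1 - cnj (Z (Suc n)) * Z (Suc (Suc n)))"
    by (intro mult_right_mono Suc.IH) auto
  finally have "norm (Z (Suc (Suc n)) - Z (Suc n)) * norm (1 - cnj (Z n) * Z (Suc n))
     \<le> norm (f 0) * norm (1 - cnj (Z (Suc n)) * Z (Suc (Suc n))) * norm (1 - cnj (Z n) * Z (Suc n))"
    by (simp add: algebra_simps)
  then show ?case
    by (rule mult_right_le_imp_le) (use norm_one_minus_cnj_mult_pos Zb in \<open>auto simp: less_imp_le\<close>)
qed

lemma orbit_ratio_tendsto:
  assumes holo: "f holomorphic_on ball 0 1" and im: "f ` ball 0 1 \<subseteq> ball 0 1"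
    and p: "p \<in> sphere 0 1" and dw: "denjoy_wolff_point f p"
    and der: "has_angular_derivative f p (of_real \<alpha>)" and \<alpha>: "0 < \<alpha>" "\<alpha> < 1"
  shows "(\<lambda>n. norm ((f ^^ Suc n) 0 - p) / norm ((f ^^ n) 0 - p)) \<longlonglongrightarrow> \<alpha>"
proof -
  obtain c where "has_angular_limit f p c" and "has_angular_limit (\<lambda>z. (f z - c) / (z - p)) p (of_real \<alpha>)"
    using der by (auto simp: has_angular_derivative_def)
  \<comment> \<open>The angular derivative only asserts that some boundary value \<open>c\<close>
    exists. Knowing \<open>c = p\<close> makes the difference quotient at \<open>Z n\<close> equal
    to the ratio of consecutive displacements from \<open>p\<close>.\<close>
  moreover from this have "c = p" using wolff_angular_limit[OF holo im p dw] by blast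
  ultimately have lim: "has_angular_limit f p p"
    and der': "has_angular_limit (\<lambda>z. (f z - p) / (z - p)) p (of_real \<alpha>)" by auto
  define Z where "Z n = (f ^^ n) 0" for n
  define w where "w n = half_plane_map p (Z n)" for n
  have Zb: "Z n \<in> ball 0 1" for n
    by (induction n) (use im in \<open>auto simp: Z_def image_subset_iff\<close>)
  have Zp: "Z \<longlonglongrightarrow> p"
    using dw by (auto simp: Z_def[abs_def] denjoy_wolff_point_def)
  have Zne: "Z n \<noteq> p" for n using Zb[of n] p by auto
  have ZSuc: "Z (Suc n) = f (Z n)" for n by (simp add: Z_def)
  have sq: "1 - (norm (Z n))\<^sup>2 > 0" for n
    using Zb[of n] by (simp add: power_less_one_iff abs_square_less_1)
  have pos: "Re (w n) > 0" for n
    unfolding w_def Re_half_plane_map[OF p Zne] using Zne[of n] sq[of n] by simp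
  have "\<exists>C>0. \<forall>n. \<bar>Im (w n)\<bar> \<le> C * Re (w n)"
  proof (rule half_plane_orbit_sector[OF pos _ _ \<alpha>])
    show "0 \<le> norm (f 0)" "norm (f 0) < 1" using im by (auto simp: image_subset_iff)
    show "norm (w (Suc n) - w n) \<le> norm (f 0) * norm (w (Suc n) + cnj (w n))" for n
      unfolding w_def
      by (intro half_plane_map_step p Zb schwarz_pick_orbit_step[OF holo im, of n, folded Z_def])
    show "Re (w n) \<le> \<alpha> * Re (w (Suc n))" for n
    proof -
      have "(norm (p - Z (Suc n)))\<^sup>2 * (1 - (norm (Z n))\<^sup>2)
        \<le> \<alpha> * ((norm (p - Z n))\<^sup>2 * (1 - (norm (Z (Suc n)))\<^sup>2))"
        using julia_angular_derivative[OF holo im p lim der' \<alpha>(1) Zb[of n]]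
        by (simp only: norm_one_minus_cnj_eq_dist[OF p] ZSuc)
      then show ?thesis
        unfolding w_def Re_half_plane_map[OF p Zne] using Zne[of n] Zne[of "Suc n"]
        by (simp add: field_simps)
    qed
  qed
  then obtain C where C: "C > 0" "\<And>n. \<bar>Im (w n)\<bar> \<le> C * Re (w n)" by blast
  define \<beta> where "\<beta> = arctan (C + 1)"
  have \<beta>: "0 < \<beta>" "\<beta> < pi / 2" using C arctan_ubound by (auto simp: \<beta>_def)
  \<comment> \<open>The radius of the Stolz angle will be \<open>cos \<beta>\<close>, safely below
    the bound \<open>2 * cos \<beta>\<close> in \<open>has_angular_limit\<close>.\<close>
  have cb: "0 < cos \<beta>" using \<beta> by (intro cos_gt_zero) auto
  have "\<forall>\<^sub>F n in sequentially. dist (Z n) p < cos \<beta>" using Zp cb by (rule tendstoD)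
  then have "\<forall>\<^sub>F n in sequentially. Z n \<in> stolz_angle p \<beta> (cos \<beta>)"
    by eventually_elim
       (auto simp: \<beta>_def dist_norm intro!: half_plane_sector_stolz p Zb C(2)[unfolded w_def] C(1))
  then have "(\<lambda>n. (f (Z n) - p) / (Z n - p)) \<longlonglongrightarrow> of_real \<alpha>"
    by (intro angular_limit_sequence[OF der' \<beta> cb _ Zp _ p]) (use cb in auto)
  from tendsto_norm[OF this] show ?thesis using \<alpha> by (simp add: norm_divide Z_def)
qed

text \<open>In logarithms the increments tend to \<open>ln \<alpha>\<close>. Half of
  \<open>e\<close> absorbs their error beyond an index \<open>m\<close>; the other half absorbs, for
  large \<open>n\<close>, the constant \<open>K\<close> contributed by the start of the
  sequence.\<close>

lemma eventually_powr_bounds_of_ratio: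
  fixes r :: "nat \<Rightarrow> real"
  assumes pos: "\<And>n. r n > 0" and lim: "(\<lambda>n. r (Suc n) / r n) \<longlonglongrightarrow> \<alpha>"
    and \<alpha>: "0 < \<alpha>" "\<alpha> < 1" and e: "0 < e"
  shows "\<forall>\<^sub>F n in sequentially. \<alpha> powr ((1 + e) * real n) \<le> r n \<and> r n \<le> \<alpha> powr ((1 - e) * real n)"
proof -
  define L where "L n = ln (r n)" for n
  have la: "ln \<alpha> < 0" using \<alpha> by simp
  have "(\<lambda>n. ln (r (Suc n) / r n)) \<longlonglongrightarrow> ln \<alpha>"
    using \<alpha> by (intro tendsto_ln lim) auto
  then have "(\<lambda>n. L (Suc n) - L n) \<longlonglongrightarrow> ln \<alpha>"
    using pos by (simp add: L_def ln_div less_imp_neq[symmetric])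
  moreover have d0: "0 < - ln \<alpha> * e / 2" using la e by (intro divide_pos_pos mult_pos_pos) auto
  ultimately have "\<forall>\<^sub>F n in sequentially. dist (L (Suc n) - L n) (ln \<alpha>) < - ln \<alpha> * e / 2"
    by (rule tendstoD)
  then obtain m where m: "\<And>n. n \<ge> m \<Longrightarrow> \<bar>L (Suc n) - L n - ln \<alpha>\<bar> \<le> - ln \<alpha> * e / 2"
    unfolding eventually_sequentially dist_real_def by (metis less_imp_le)
  have b: "\<bar>L n - L m - real (n - m) * ln \<alpha>\<bar> \<le> real (n - m) * (- ln \<alpha> * e / 2)" if "n \<ge> m" for n
    using that
  proof (induction rule: dec_induct)
    case base
    then show ?case by simp
  next
    case (step n)
    have "real (Suc n - m) = real (n - m) + 1" using step by (simp add: Suc_diff_le)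
    then have "L (Suc n) - L m - real (Suc n - m) * ln \<alpha>
      = (L n - L m - real (n - m) * ln \<alpha>) + (L (Suc n) - L n - ln \<alpha>)"
      by (simp add: algebra_simps)
    moreover have "real (Suc n - m) * (- ln \<alpha> * e / 2) = real (n - m) * (- ln \<alpha> * e / 2) + (- ln \<alpha> * e / 2)"
      using \<open>real (Suc n - m) = real (n - m) + 1\<close> by (simp only: distrib_right mult_1)
    ultimately show ?case using step.IH m[OF step(1)] by linarith
  qed
  define K where "K = \<bar>L m\<bar> + real m * (- ln \<alpha>)"
  have "\<forall>\<^sub>F n in sequentially. K / (- ln \<alpha> * e / 2) \<le> real n"
    using filterlim_real_sequentially unfolding filterlim_at_top by blast
  then show ?thesis using eventually_ge_at_top[of m]
  proof eventually_elim
    case (elim n)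
    have K: "K \<le> real n * (- ln \<alpha> * e / 2)"
      using elim(1) d0 by (simp only: divide_le_eq if_True)
    have "real (n - m) * (- ln \<alpha> * e / 2) \<le> real n * (- ln \<alpha> * e / 2)"
      using d0 by (intro mult_right_mono) auto
    moreover have "real (n - m) = real n - real m" using elim by simp
    ultimately have "\<bar>L n - real n * ln \<alpha>\<bar> \<le> K + real n * (- ln \<alpha> * e / 2)"
    proof -
      have "L n - real n * ln \<alpha> = (L n - L m - real (n - m) * ln \<alpha>) + L m + real m * (- ln \<alpha>)"
        using \<open>real (n - m) = real n - real m\<close> by (simp add: algebra_simps)
      moreover have "0 \<le> real m * (- ln \<alpha>)" using la by (intro mult_nonneg_nonneg) auto
      ultimately show ?thesis
        using b[OF elim(2)] \<open>real (n - m) * (- ln \<alpha> * e / 2) \<le> real n * (- ln \<alpha> * e / 2)\<close>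
        unfolding K_def by linarith
    qed
    also have "\<dots> \<le> real n * (- ln \<alpha> * e)" using K by simp
    finally have "(1 + e) * real n * ln \<alpha> \<le> L n" "L n \<le> (1 - e) * real n * ln \<alpha>"
      by (auto simp: abs_le_iff algebra_simps)
    moreover have "r n = exp (L n)" using pos[of n] by (simp add: L_def)
    ultimately show ?case using \<alpha> by (simp add: powr_def)
  qed
qed

section \<open>Harmonic measure\<close>

lemma sets_circle_measure [measurable_cong]: "sets circle_measure = sets (restrict_space borel (sphere 0 1))"
  by (simp add: circle_measure_def)

lemma space_circle_measure: "space circle_measure = sphere 0 1"
  by (simp add: circle_measure_def space_restrict_space)

lemma finite_measure_circle_measure: "finite_measure circle_measure"
  by (rule finite_measureI) (simp add: space_circle_measure emeasure_circle_measure_sphere)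

lemma borel_measurable_circle:
  fixes g :: "complex \<Rightarrow> 'b::topological_space"
  assumes "sets M = sets circle_measure" and "continuous_on (sphere 0 1) g"
  shows "g \<in> borel_measurable M"
proof -
  have "g \<in> borel_measurable (restrict_space borel (sphere 0 1))"
    using assms(2) by (rule borel_measurable_continuous_on_restrict)
  then show ?thesis
    using measurable_cong_sets[OF assms(1)[unfolded sets_circle_measure] refl] by blast
qed

lemma integrable_circle:
  fixes g :: "complex \<Rightarrow> 'b::{banach, second_countable_topology}"
  assumes M: "finite_measure M" "sets M = sets circle_measure" and g: "continuous_on (sphere 0 1) g"
  shows "integrable M g"
proof -
  obtain B where B: "\<And>w. w \<in> sphere 0 1 \<Longrightarrow> norm (g w) \<le> B"
    using compact_imp_bounded[OF compact_continuous_image[OF g compact_sphere]]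
    unfolding bounded_iff by (metis imageI)
  have "space M = sphere 0 1"
    using sets_eq_imp_space_eq[OF M(2)] by (simp add: space_circle_measure)
  then show ?thesis
    by (intro finite_measure.integrable_const_bound[OF M(1), of _ B] borel_measurable_circle M g)
       (auto intro!: AE_I2 B)
qed

text \<open>Connects the pushforward under \<open>cis\<close> with the gauge integral over the
  angle, the form in which contour integrals over circles are evaluated.\<close>

lemma integral_circle_measure:
  fixes g :: "complex \<Rightarrow> complex"
  assumes g: "continuous_on (sphere 0 1) g" and I: "((\<lambda>t. g (cis t)) has_integral I) {0..2 * pi}"
  shows "integral\<^sup>L circle_measure g = I / (2 * pi)"
proof -
  have cg: "continuous_on UNIV (\<lambda>t. g (cis t))"
    by (rule continuous_on_compose2[OF g]) (auto intro: continuous_intros)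
  have mg [measurable]: "(\<lambda>t. g (cis t)) \<in> borel_measurable lborel"
    using borel_measurable_continuous_onI[OF cg] by simp
  have "integral\<^sup>L circle_measure g = (\<integral>t. g (cis t) \<partial>uniform_measure lborel {0..<2 * pi})"
    unfolding circle_measure_def
    by (intro integral_distr cis_measurable_circle borel_measurable_continuous_on_restrict g)
  also have "uniform_measure lborel {0..<2 * pi} = density lborel (\<lambda>t. ennreal (indicator {0..<2 * pi} t / (2 * pi)))"
    unfolding uniform_measure_def
    by (intro density_cong) (auto simp: divide_ennreal[symmetric] split: split_indicator)
  also have "(\<integral>t. g (cis t) \<partial>\<dots>) = (\<integral>t. (indicator {0..<2 * pi} t / (2 * pi)) *\<^sub>R g (cis t) \<partial>lborel)"
    by (intro integral_density) auto
  also have "\<dots> = (\<integral>t. (1 / (2 * pi)) *\<^sub>R (indicator {0..2 * pi} t *\<^sub>R g (cis t)) \<partial>lborel)"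
  \<comment> \<open>The half-open and the closed interval differ only in the null point
    \<open>2 * pi\<close>.\<close>
  proof (intro integral_cong_AE)
    show "AE t in lborel. (indicator {0..<2 * pi} t / (2 * pi)) *\<^sub>R g (cis t)
        = (1 / (2 * pi)) *\<^sub>R (indicator {0..2 * pi} t *\<^sub>R g (cis t))"
      using AE_lborel_singleton[of "2 * pi"] by eventually_elim (auto split: split_indicator)
  qed auto
  also have "\<dots> = (1 / (2 * pi)) *\<^sub>R (LINT t:{0..2 * pi}|lborel. g (cis t))"
    unfolding set_lebesgue_integral_def by (rule integral_scaleR_right)
  also have "(LINT t:{0..2 * pi}|lborel. g (cis t)) = integral {0..2 * pi} (\<lambda>t. g (cis t))"
    by (intro set_borel_integral_eq_integral borel_integrable_atLeastAtMost' continuous_on_subset[OF cg]) auto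
  also have "\<dots> = I" using I by (rule integral_unique)
  finally show ?thesis by (simp add: scaleR_conv_of_real)
qed

section \<open>Poisson kernel and Poisson formula\<close>

definition poisson_kernel :: "complex \<Rightarrow> complex \<Rightarrow> real" where
  "poisson_kernel z \<zeta> = (1 - (norm z)\<^sup>2) / (norm (\<zeta> - z))\<^sup>2"

text \<open>Given by a density so that null sets of the circle measure are null here at once;
  evaluation of holomorphic functions at \<open>z\<close> is then a theorem.\<close>

definition harmonic_measure :: "complex \<Rightarrow> complex measure" where
  "harmonic_measure z = density circle_measure (\<lambda>\<zeta>. ennreal (poisson_kernel z \<zeta>))"

lemma sets_harmonic_measure [simp, measurable_cong]: "sets (harmonic_measure z) = sets circle_measure"
  by (simp add: harmonic_measure_def)

lemma space_harmonic_measure [simp]: "space (harmonic_measure z) = sphere 0 1"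
  by (simp add: harmonic_measure_def space_circle_measure)

lemma poisson_kernel_nonneg:
  assumes "z \<in> ball 0 1"
  shows "poisson_kernel z \<zeta> \<ge> 0"
proof -
  have "(norm z)\<^sup>2 \<le> 1" using assms by (simp add: power_le_one)
  then show ?thesis by (simp add: poisson_kernel_def)
qed

lemma continuous_on_poisson_kernel:
  assumes "z \<in> ball 0 1"
  shows "continuous_on (sphere 0 1) (poisson_kernel z)"
  unfolding poisson_kernel_def[abs_def] using assms by (intro continuous_intros) auto

lemma borel_measurable_poisson_kernel:
  assumes "z \<in> ball 0 1"
  shows "poisson_kernel z \<in> borel_measurable circle_measure"
  by (intro borel_measurable_circle continuous_on_poisson_kernel assms refl)

lemma harmonic_measure_0: "harmonic_measure 0 = circle_measure"
proof -
  have "poisson_kernel 0 \<zeta> = 1" if "norm \<zeta> = 1" for \<zeta>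
    using that by (simp add: poisson_kernel_def)
  then have "harmonic_measure 0 = density circle_measure (\<lambda>_. 1)"
    unfolding harmonic_measure_def
    using borel_measurable_poisson_kernel[of 0]
    by (intro density_cong) (auto intro!: AE_I2 simp: space_circle_measure)
  then show ?thesis by (simp add: density_1)
qed

lemma AE_harmonic_measureI:
  assumes "z \<in> ball 0 1" and "AE \<zeta> in circle_measure. P \<zeta>"
  shows "AE \<zeta> in harmonic_measure z. P \<zeta>"
  unfolding harmonic_measure_def
  using assms borel_measurable_poisson_kernel[of z] by (subst AE_density) auto

lemma finite_measure_harmonic_measure:
  assumes z: "z \<in> ball 0 1"
  shows "finite_measure (harmonic_measure z)"
proof (rule finite_measureI)
  have "integrable circle_measure (poisson_kernel z)"
    by (intro integrable_circle finite_measure_circle_measure continuous_on_poisson_kernel z refl)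
  then have "(\<integral>\<^sup>+\<zeta>. ennreal (norm (poisson_kernel z \<zeta>)) \<partial>circle_measure) < \<infinity>"
    by (simp add: integrable_iff_bounded)
  then show "emeasure (harmonic_measure z) (space (harmonic_measure z)) \<noteq> \<infinity>"
    using borel_measurable_poisson_kernel[OF z] poisson_kernel_nonneg[OF z]
    unfolding harmonic_measure_def
    by (subst emeasure_density) (auto simp: nn_integral_set_ennreal cong: nn_integral_cong_simp)
qed

text \<open>Applied to powers this yields the moments that determine the measure; applied to square
  roots it yields the tail estimates.\<close>

lemma integral_harmonic_measure:
  assumes G: "continuous_on (cball 0 1) G" "G holomorphic_on ball 0 1" and z: "z \<in> ball 0 1"
  shows "integral\<^sup>L (harmonic_measure z) G = G z"
proof -
  have ne: "1 - cnj z * w \<noteq> 0" if "w \<in> cball 0 1" for w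
  proof
    assume "1 - cnj z * w = 0"
    then have "norm z * norm w = 1" by (metis norm_mult complex_mod_cnj norm_one right_minus_eq)
    moreover have "norm z * norm w \<le> norm z" using that by (simp add: mult_left_le)
    ultimately show False using z by simp
  qed
  have Gs: "continuous_on (sphere 0 1) G" using G(1) by (rule continuous_on_subset) auto
  \<comment> \<open>On the circle \<open>cnj \<zeta> = 1 / \<zeta>\<close>, so the Poisson kernel equals
    \<open>(1 - |z|\<^sup>2) \<zeta> / ((\<zeta> - z) (1 - cnj z \<zeta>))\<close> and Cauchy's formula applies to \<open>H\<close>.\<close>
  define H where "H w = G w * (1 - cnj z * z) / (1 - cnj z * w)" for w
  have "((\<lambda>u. H u / (u - z)) has_contour_integral (2 * of_real pi * \<i> * H z)) (circlepath 0 1)"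
  proof (rule Cauchy_integral_circlepath)
    show "continuous_on (cball 0 1) H"
      unfolding H_def using ne by (intro continuous_intros G) auto
    show "H holomorphic_on ball 0 1"
      unfolding H_def using ne by (intro holomorphic_intros G) auto
  qed (use z in auto)
  moreover have "H z = G z" using ne[of z] z by (simp add: H_def)
  ultimately have "((\<lambda>t. H (cis t) / (cis t - z) * \<i> * cis t) has_integral (2 * of_real pi * \<i> * G z)) {0..2 * pi}"
    unfolding circlepath_def by (subst (asm) has_contour_integral_part_circlepath_iff) auto
  also have "(\<lambda>t. H (cis t) / (cis t - z) * \<i> * cis t) = (\<lambda>t. \<i> * (poisson_kernel z (cis t) *\<^sub>R G (cis t)))"
  proof
    fix t
    have "(of_real ((norm (cis t - z))\<^sup>2) :: complex) = (cis t - z) * (cnj (cis t) - cnj z)"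
      by (simp only: complex_norm_square complex_cnj_diff)
    also have "\<dots> * cis t = (cis t - z) * (1 - cnj z * cis t)"
      by (simp add: algebra_simps cis_cnj cis_mult)
    finally have e: "of_real ((norm (cis t - z))\<^sup>2) * cis t = (cis t - z) * (1 - cnj z * cis t)" .
    have nz: "cis t - z \<noteq> 0" using z by (metis mem_ball_0 norm_cis less_irrefl right_minus_eq)
    have "of_real (poisson_kernel z (cis t)) = (1 - cnj z * z) * cis t / (of_real ((norm (cis t - z))\<^sup>2) * cis t)"
      using nz by (simp add: poisson_kernel_def complex_norm_square[of z, simplified] mult.commute)
    also have "\<dots> = (1 - cnj z * z) * cis t / ((cis t - z) * (1 - cnj z * cis t))"
      by (simp only: e)
    finally show "H (cis t) / (cis t - z) * \<i> * cis t = \<i> * (poisson_kernel z (cis t) *\<^sub>R G (cis t))"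
      by (simp add: H_def scaleR_conv_of_real mult_ac)
  qed
  \<comment> \<open>Multiplying by \<open>- \<i>\<close> removes the factor \<open>\<i>\<close> that
    comes from differentiating \<open>cis\<close>.\<close>
  finally have "((\<lambda>t. - \<i> * (\<i> * (poisson_kernel z (cis t) *\<^sub>R G (cis t)))) has_integral (- \<i> * (2 * of_real pi * \<i> * G z))) {0..2 * pi}"
    by (rule has_integral_mult_right)
  then have "((\<lambda>t. poisson_kernel z (cis t) *\<^sub>R G (cis t)) has_integral (2 * of_real pi * G z)) {0..2 * pi}"
    by (simp add: mult.assoc[symmetric]) (simp add: mult.assoc mult.left_commute)
  then have "(\<integral>\<zeta>. poisson_kernel z \<zeta> *\<^sub>R G \<zeta> \<partial>circle_measure) = G z"
    by (subst integral_circle_measure) (auto intro!: continuous_intros continuous_on_poisson_kernel z Gs)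
  then show ?thesis
    unfolding harmonic_measure_def using z
    by (subst integral_density)
       (auto intro!: borel_measurable_poisson_kernel poisson_kernel_nonneg borel_measurable_circle Gs)
qed

section \<open>Measures on the circle are determined by their moments\<close>

lemma mult_cnj_sphere:
  assumes "w \<in> sphere 0 1"
  shows "w * cnj w = 1"
  using assms by (simp add: complex_norm_square[symmetric])

text \<open>On the circle a mixed monomial collapses to a pure power or to the conjugate of one, so
  the holomorphic moments decide all of them.\<close>

lemma integral_monomial_eq:
  assumes eq: "\<And>k. (\<integral>w. w ^ k \<partial>M) = (\<integral>w. w ^ k \<partial>N)"
    and M: "space M = sphere 0 1" and N: "space N = sphere 0 (1::real)"
  shows "(\<integral>w. w ^ k * cnj w ^ l \<partial>M) = (\<integral>w. w ^ k * cnj w ^ l \<partial>N)"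
proof (cases "l \<le> k")
  case True
  have e: "w ^ k * cnj w ^ l = w ^ (k - l)" if "w \<in> sphere 0 1" for w :: complex
  proof -
    have "w ^ k * cnj w ^ l = w ^ (k - l) * (w * cnj w) ^ l"
      using True by (simp add: power_mult_distrib power_add[symmetric])
    then show ?thesis using that by (simp only: mult_cnj_sphere) simp
  qed
  have "(\<integral>w. w ^ k * cnj w ^ l \<partial>M) = (\<integral>w. w ^ (k - l) \<partial>M)"
    by (rule Bochner_Integration.integral_cong) (simp_all only: e M)
  moreover have "(\<integral>w. w ^ k * cnj w ^ l \<partial>N) = (\<integral>w. w ^ (k - l) \<partial>N)"
    by (rule Bochner_Integration.integral_cong) (simp_all only: e N)
  ultimately show ?thesis by (simp add: eq)
next
  case False
  have e: "w ^ k * cnj w ^ l = cnj (w ^ (l - k))" if "w \<in> sphere 0 1" for w :: complex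
  proof -
    have "w ^ k * cnj w ^ l = cnj w ^ (l - k) * (w * cnj w) ^ k"
      using False by (simp add: power_mult_distrib power_add[symmetric] mult_ac)
    then show ?thesis using that by (simp only: mult_cnj_sphere) simp
  qed
  have "(\<integral>w. w ^ k * cnj w ^ l \<partial>M) = (\<integral>w. cnj (w ^ (l - k)) \<partial>M)"
    by (rule Bochner_Integration.integral_cong) (simp_all only: e M)
  moreover have "(\<integral>w. w ^ k * cnj w ^ l \<partial>N) = (\<integral>w. cnj (w ^ (l - k)) \<partial>N)"
    by (rule Bochner_Integration.integral_cong) (simp_all only: e N)
  ultimately show ?thesis using eq[of "l - k"] by (simp only: Bochner_Integration.integral_cnj)
qed

lemma integral_real_polynomial_eq:
  assumes M: "finite_measure M" "sets M = sets circle_measure"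
    and N: "finite_measure N" "sets N = sets circle_measure"
    and eq: "\<And>k. (\<integral>w. w ^ k \<partial>M) = (\<integral>w. w ^ k \<partial>N)"
    and q: "real_polynomial_function q"
  shows "(\<integral>w. q w \<partial>M) = (\<integral>w. q w \<partial>N)"
proof -
  \<comment> \<open>Testing against all monomials makes \<open>E\<close> stable under multiplication by \<open>w\<close> and \<open>cnj w\<close>,
    hence by real polynomials.\<close>
  define E where "E = {\<phi>. continuous_on (sphere 0 1) \<phi> \<and>
    (\<forall>k l. (\<integral>w. w ^ k * cnj w ^ l * \<phi> w \<partial>M) = (\<integral>w. w ^ k * cnj w ^ l * \<phi> w \<partial>N))}"
  have int: "integrable M (\<lambda>w. w ^ k * cnj w ^ l * \<phi> w)" "integrable N (\<lambda>w. w ^ k * cnj w ^ l * \<phi> w)"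
    if "\<phi> \<in> E" for k l \<phi>
    using that by (auto simp: E_def intro!: integrable_circle M N continuous_intros)
  have addE: "(\<lambda>w. \<phi> w + \<psi> w) \<in> E" if "\<phi> \<in> E" "\<psi> \<in> E" for \<phi> \<psi>
    using that int[OF that(1)] int[OF that(2)] by (auto simp: E_def distrib_left intro!: continuous_intros)
  have scaleE: "(\<lambda>w. c * \<phi> w) \<in> E" if "\<phi> \<in> E" for c \<phi>
    using that by (auto simp: E_def mult.left_commute[of _ c] intro!: continuous_intros)
  have idE: "(\<lambda>w. w * \<phi> w) \<in> E" if "\<phi> \<in> E" for \<phi>
  proof -
    have e: "w ^ k * cnj w ^ l * (w * \<phi> w) = w ^ Suc k * cnj w ^ l * \<phi> w" for k l w by simp
    show ?thesis using that unfolding E_def mem_Collect_eq e by (auto intro!: continuous_intros simp del: power_Suc)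
  qed
  have cnjE: "(\<lambda>w. cnj w * \<phi> w) \<in> E" if "\<phi> \<in> E" for \<phi>
  proof -
    have e: "w ^ k * cnj w ^ l * (cnj w * \<phi> w) = w ^ k * cnj w ^ Suc l * \<phi> w" for k l w by simp
    show ?thesis using that unfolding E_def mem_Collect_eq e by (auto intro!: continuous_intros simp del: power_Suc)
  qed
  have "(\<lambda>w. of_real (q w) * \<phi> w) \<in> E" if "\<phi> \<in> E" for \<phi>
    using q that
  proof (induction arbitrary: \<phi>)
    case (linear g)
    interpret bounded_linear g by fact
    \<comment> \<open>A real-linear functional on the plane has the form
      \<open>c * w + cnj c * cnj w\<close>; its values at 1 and \<open>\<i>\<close> determine
      \<open>c\<close>.\<close>
    define c where "c = (of_real (g 1) - \<i> * of_real (g \<i>)) / 2"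
    have "of_real (g w) = c * w + cnj c * cnj w" for w
    proof -
      have "w = Re w *\<^sub>R 1 + Im w *\<^sub>R \<i>" by (simp add: complex_eq_iff)
      then have "g w = Re w * g 1 + Im w * g \<i>"
        by (metis add scaleR real_scaleR_def)
      then show ?thesis by (simp add: c_def complex_eq_iff field_simps)
    qed
    then have "(\<lambda>w. of_real (g w) * \<phi> w) = (\<lambda>w. c * (w * \<phi> w) + cnj c * (cnj w * \<phi> w))"
      by (simp add: algebra_simps)
    then show ?case
      by (simp only: addE scaleE idE cnjE linear.prems)
  next
    case (const c)
    then show ?case by (rule scaleE)
  next
    case (add f g)
    then show ?case by (simp add: distrib_right addE)
  next
    \<comment> \<open>The induction is over all \<open>\<phi>\<close>: first
      \<open>g * \<phi>\<close> lies in \<open>E\<close>, then the hypothesis for \<open>f\<close>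
      applies to it.\<close>
    case (mult f g)
    then show ?case by (simp add: mult.assoc)
  qed
  moreover have "space M = sphere 0 1" "space N = sphere 0 1"
    using sets_eq_imp_space_eq[OF M(2)] sets_eq_imp_space_eq[OF N(2)] by (simp_all add: space_circle_measure)
  then have "(\<lambda>_. 1) \<in> E"
    using integral_monomial_eq[OF eq] by (auto simp: E_def)
  ultimately have "(\<lambda>w. of_real (q w) * 1) \<in> E" by blast
  then have "(\<integral>w. w ^ 0 * cnj w ^ 0 * (complex_of_real (q w) * 1) \<partial>M) = (\<integral>w. w ^ 0 * cnj w ^ 0 * (complex_of_real (q w) * 1) \<partial>N)"
    unfolding E_def by blast
  then show ?thesis by simp
qed

text \<open>Stone-Weierstrass: real polynomials are uniformly dense on the circle, and integration
  against a finite measure is uniformly continuous.\<close>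

lemma integral_continuous_eq:
  fixes \<phi> :: "complex \<Rightarrow> real"
  assumes M: "finite_measure M" "sets M = sets circle_measure"
    and N: "finite_measure N" "sets N = sets circle_measure"
    and eq: "\<And>k. (\<integral>w. w ^ k \<partial>M) = (\<integral>w. w ^ k \<partial>N)"
    and \<phi>: "continuous_on (sphere 0 1) \<phi>"
  shows "(\<integral>w. \<phi> w \<partial>M) = (\<integral>w. \<phi> w \<partial>N)"
proof -
  have sp: "space M = sphere 0 1" "space N = sphere 0 1"
    using sets_eq_imp_space_eq[OF M(2)] sets_eq_imp_space_eq[OF N(2)] by (simp_all add: space_circle_measure)
  \<comment> \<open>With \<open>K\<close> above the combined mass, a uniform error
    \<open>e / K\<close> costs at most \<open>e\<close> in total; the summand 1 keeps
    \<open>K\<close> positive even for zero measures.\<close>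
  define K where "K = measure M (space M) + measure N (space N) + 1"
  have K: "K > 0" by (auto simp: K_def intro: add_nonneg_pos)
  have le: "\<bar>(\<integral>w. \<phi> w \<partial>M) - (\<integral>w. \<phi> w \<partial>N)\<bar> \<le> e" if e: "e > 0" for e
  proof -
    obtain g where g: "real_polynomial_function g" "\<And>w. w \<in> sphere 0 1 \<Longrightarrow> \<bar>\<phi> w - g w\<bar> < e / K"
      using Stone_Weierstrass_real_polynomial_function[OF compact_sphere \<phi> divide_pos_pos[OF e K]] by blast
    have cg: "continuous_on (sphere 0 1) g"
      using g(1) continuous_on_polymonial_function real_polynomial_function_eq by blast
    have close: "\<bar>(\<integral>w. \<phi> w \<partial>L) - (\<integral>w. g w \<partial>L)\<bar> \<le> e / K * measure L (space L)"
      if L: "finite_measure L" "sets L = sets circle_measure" "space L = sphere 0 1" for L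
    proof -
      have i: "integrable L \<phi>" "integrable L g"
        by (intro integrable_circle L \<phi> cg)+
      then have "\<bar>(\<integral>w. \<phi> w \<partial>L) - (\<integral>w. g w \<partial>L)\<bar> = \<bar>\<integral>w. \<phi> w - g w \<partial>L\<bar>" by simp
      also have "\<dots> \<le> (\<integral>w. \<bar>\<phi> w - g w\<bar> \<partial>L)" by (rule integral_abs_bound)
      also have "\<dots> \<le> (\<integral>w. e / K \<partial>L)"
        using g(2) L(3) i finite_measure.integrable_const[OF L(1)]
        by (intro integral_mono integrable_abs Bochner_Integration.integrable_diff) (auto simp: less_imp_le)
      finally show ?thesis by (simp add: mult.commute)
    qed
    have "\<bar>(\<integral>w. \<phi> w \<partial>M) - (\<integral>w. \<phi> w \<partial>N)\<bar> \<le> e / K * measure M (space M) + e / K * measure N (space N)"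
      using close[OF M sp(1)] close[OF N sp(2)] integral_real_polynomial_eq[OF M N eq g(1)] by linarith
    also have "\<dots> \<le> e / K * K"
      unfolding distrib_left[symmetric] using e K by (intro mult_left_mono) (simp_all add: K_def)
    finally show ?thesis using K by simp
  qed
  have "\<bar>(\<integral>w. \<phi> w \<partial>M) - (\<integral>w. \<phi> w \<partial>N)\<bar> \<le> 0"
  proof (rule field_le_epsilon)
    fix e :: real
    assume "0 < e"
    then show "\<bar>(\<integral>w. \<phi> w \<partial>M) - (\<integral>w. \<phi> w \<partial>N)\<bar> \<le> 0 + e"
      using le[of e] by simp
  qed
  then show ?thesis by simp
qed

text \<open>The closed subsets of the circle form an intersection-stable generator, and the
  indicator of a closed set is a bounded pointwise limit of continuous functions.\<close>

lemma measure_eqI_moments: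
  assumes M: "finite_measure M" "sets M = sets circle_measure"
    and N: "finite_measure N" "sets N = sets circle_measure"
    and eq: "\<And>k. (\<integral>w. w ^ k \<partial>M) = (\<integral>w. w ^ k \<partial>N)"
  shows "M = N"
proof -
  let ?S = "sphere 0 1 :: complex set"
  let ?E = "(\<inter>) ?S ` Collect closed"
  have S: "?S \<in> sigma_sets UNIV (Collect closed)" by (rule sigma_sets.Basic) simp
  have "sets (borel :: complex measure) = sigma_sets UNIV (Collect closed)"
    unfolding borel_eq_closed by (rule sets_measure_of) simp
  then have "sets (restrict_space borel ?S) = sigma_sets ?S ?E"
    unfolding sets_restrict_space using sigma_sets_Int[OF S subset_UNIV] by simp
  then have sigma: "sets circle_measure = sigma_sets ?S ?E"
    by (simp add: sets_circle_measure)
  have sp: "space L = ?S" if "sets L = sets circle_measure" for L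
    using sets_eq_imp_space_eq[OF that] by (simp add: space_circle_measure)
  show ?thesis
  proof (rule measure_eqI_generator_eq[where E="?E" and \<Omega>="?S" and A="\<lambda>_. ?S"])
    show "Int_stable ?E"
    proof (rule Int_stableI)
      fix a b assume "a \<in> ?E" "b \<in> ?E"
      then obtain a' b' where "a = ?S \<inter> a'" "b = ?S \<inter> b'" "closed a'" "closed b'" by auto
      then show "a \<inter> b \<in> ?E" by (intro image_eqI[of _ _ "a' \<inter> b'"]) auto
    qed
    fix X assume "X \<in> ?E"
    then have X: "closed X" "X \<subseteq> ?S" by auto
    have mX: "X \<in> sets circle_measure" using \<open>X \<in> ?E\<close> unfolding sigma by (rule sigma_sets.Basic)
    show "emeasure M X = emeasure N X"
    \<comment> \<open>\<open>infdist w {}\<close> is 0 by convention, so the functions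
      \<open>\<phi> n\<close> below would be constantly 1 for the empty set.\<close>
    proof (cases "X = {}")
      case False
      define \<phi> where "\<phi> n w = max 0 (1 - real n * infdist w X)" for n w
      have c\<phi>: "continuous_on ?S (\<phi> n)" for n
        unfolding \<phi>_def by (intro continuous_intros)
      have lim: "(\<lambda>n. \<phi> n w) \<longlonglongrightarrow> indicator X w" for w
      proof (cases "w \<in> X")
        case True
        then show ?thesis by (simp add: \<phi>_def)
      next
        case F: False
        then have d: "infdist w X > 0"
          using in_closed_iff_infdist_zero[OF X(1) False, of w] infdist_nonneg[of w X] by (simp add: less_le)
        have "\<forall>\<^sub>F n in sequentially. 1 / infdist w X \<le> real n"
          using filterlim_real_sequentially unfolding filterlim_at_top by blast
        then have "\<forall>\<^sub>F n in sequentially. \<phi> n w = indicator X w"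
          by eventually_elim (use d F in \<open>auto simp: \<phi>_def divide_le_eq\<close>)
        then show ?thesis by (rule tendsto_eventually)
      qed
      have conv: "(\<lambda>n. \<integral>w. \<phi> n w \<partial>L) \<longlonglongrightarrow> measure L X"
        if L: "finite_measure L" "sets L = sets circle_measure" for L
      proof -
        have "(\<lambda>n. \<integral>w. \<phi> n w \<partial>L) \<longlonglongrightarrow> (\<integral>w. indicator X w \<partial>L)"
        proof (rule integral_dominated_convergence[where w="\<lambda>_. 1"])
          show "indicator X \<in> borel_measurable L" using mX L(2) by simp
          show "\<phi> n \<in> borel_measurable L" for n by (intro borel_measurable_circle L c\<phi>)
          show "integrable L (\<lambda>_. 1)" using L(1) by (rule finite_measure.integrable_const)
        qed (use lim in \<open>auto intro!: AE_I2 simp: \<phi>_def infdist_nonneg\<close>)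
        then show ?thesis using X(2) sp[OF L(2)] by (simp add: Int_absorb2)
      qed
      have "measure M X = measure N X"
        using conv[OF M] conv[OF N] integral_continuous_eq[OF M N eq c\<phi>]
        by (simp add: LIMSEQ_unique)
      then show ?thesis
        by (simp add: finite_measure.emeasure_eq_measure[OF M(1)] finite_measure.emeasure_eq_measure[OF N(1)])
    qed simp
  next
    show "sets M = sigma_sets ?S ?E" "sets N = sigma_sets ?S ?E" using M N sigma by auto
    show "range (\<lambda>_. ?S) \<subseteq> ?E" by auto
    show "emeasure M ?S \<noteq> \<infinity>" using finite_measure.emeasure_finite[OF M(1)] by simp
  qed auto
qed

section \<open>Tail estimates\<close>

lemma norm_le_norm_add_of_real:
  fixes u :: complex
  assumes "0 \<le> Re u" "0 \<le> d"
  shows "norm u \<le> norm (u + of_real d)"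
proof -
  have "(Re u)\<^sup>2 \<le> (Re u + d)\<^sup>2" using assms by (intro power_mono) auto
  then show ?thesis by (simp add: cmod_def)
qed

text \<open>The real part of \<open>csqrt u\<close> is \<open>sqrt ((norm u + Re u) / 2)\<close>. On
  the right half-plane it is thus comparable to the modulus, which is why square roots serve as test
  functions.\<close>

lemma Re_csqrt_ge:
  assumes "0 \<le> Re u"
  shows "sqrt (norm u / 2) \<le> Re (csqrt u)"
  using assms by simp

lemma Re_csqrt_nonneg: "0 \<le> Re (csqrt u)"
  using csqrt_principal[of u] by (auto simp del: csqrt.sel)

lemma norm_csqrt: "norm (csqrt u) = sqrt (norm u)"
  by (metis norm_ge_zero norm_power power2_csqrt real_sqrt_unique)

text \<open>Markov's inequality for \<open>Re h\<close>, whose integral is \<open>Re (h z)\<close>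
  by the Poisson formula.\<close>

lemma harmonic_measure_markov:
  assumes h: "continuous_on (cball 0 1) h" "h holomorphic_on ball 0 1" and z: "z \<in> ball 0 1"
    and nonneg: "\<And>w. w \<in> sphere 0 1 \<Longrightarrow> 0 \<le> Re (h w)"
    and A: "A \<in> sets circle_measure" and t: "0 < t" "\<And>w. w \<in> A \<Longrightarrow> t \<le> Re (h w)"
  shows "measure (harmonic_measure z) A \<le> norm (h z) / t"
proof -
  note fin = finite_measure_harmonic_measure[OF z]
  have hs: "continuous_on (sphere 0 1) h" using h(1) by (rule continuous_on_subset) auto
  have As: "A \<subseteq> sphere 0 1" using sets.sets_into_space[OF A] by (simp add: space_circle_measure)
  have int: "integrable (harmonic_measure z) h"
    by (intro integrable_circle fin hs) simp
  have "t * measure (harmonic_measure z) A = (\<integral>w. t * indicator A w \<partial>harmonic_measure z)"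
    using As by (simp add: Int_absorb2)
  also have "\<dots> \<le> (\<integral>w. Re (h w) \<partial>harmonic_measure z)"
  proof (rule integral_mono)
    show "integrable (harmonic_measure z) (\<lambda>w. t * indicator A w)"
      using A finite_measure.emeasure_finite[OF fin] by (simp add: less_top)
    show "t * indicator A w \<le> Re (h w)" if "w \<in> space (harmonic_measure z)" for w
      using that t(2) nonneg by (auto split: split_indicator)
  qed (use int in simp)
  also have "\<dots> = Re (h z)"
    using int integral_harmonic_measure[OF h z] by simp
  also have "\<dots> \<le> norm (h z)" by (rule complex_Re_le_cmod)
  finally show ?thesis using t(1) by (simp add: le_divide_eq mult.commute)
qed

lemma Re_one_minus_cnj_nonneg:
  assumes p: "p \<in> sphere 0 1" and "w \<in> cball 0 1"
  shows "0 \<le> Re (1 - cnj p * w)"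
proof -
  have "Re (cnj p * w) \<le> norm (cnj p * w)" by (rule complex_Re_le_cmod)
  also have "\<dots> \<le> 1" using assms p by (simp add: norm_mult)
  finally show ?thesis by simp
qed

lemma circle_sets_dist:
  "{w \<in> sphere 0 1. d \<le> norm (w - p)} \<in> sets circle_measure"
  "{w \<in> sphere 0 1. norm (w - p) \<le> d} \<in> sets circle_measure"
proof -
  have [measurable]: "(\<lambda>w. norm (w - p)) \<in> borel_measurable circle_measure"
    by (intro borel_measurable_circle refl continuous_intros)
  have "{w \<in> space circle_measure. d \<le> norm (w - p)} \<in> sets circle_measure"
    "{w \<in> space circle_measure. norm (w - p) \<le> d} \<in> sets circle_measure" by measurable
  then show "{w \<in> sphere 0 1. d \<le> norm (w - p)} \<in> sets circle_measure"
    "{w \<in> sphere 0 1. norm (w - p) \<le> d} \<in> sets circle_measure"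
    by (simp_all only: space_circle_measure)
qed

context
  fixes p z :: complex
  assumes p: "p \<in> sphere 0 1" and z: "z \<in> ball 0 1"
begin

lemma harmonic_measure_far:
  assumes d: "0 < d"
  shows "measure (harmonic_measure z) {w \<in> sphere 0 1. d \<le> norm (w - p)} \<le> 2 * sqrt (norm (z - p) / d)"
proof -
  \<comment> \<open>Shifting by the distance from \<open>z\<close> to \<open>p\<close> keeps
    \<open>u\<close> off the branch cut on the closed disc, at \<open>p\<close> too, while
    \<open>norm (u z)\<close> is still at most \<open>2 * \<delta>\<close>.\<close>
  define \<delta> where "\<delta> = norm (z - p)"
  have \<delta>: "\<delta> > 0" using p z by (auto simp: \<delta>_def)
  define u where "u w = (1 - cnj p * w) + of_real \<delta>" for w
  have Re_u: "Re (u w) > 0" if "w \<in> cball 0 1" for w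
    using Re_one_minus_cnj_nonneg[OF p that] \<delta> by (simp add: u_def)
  then have nr: "u w \<notin> \<real>\<^sub>\<le>\<^sub>0" if "w \<in> cball 0 1" for w
    using that by (fastforce simp: complex_nonpos_Reals_iff)
  have hol: "(\<lambda>w. csqrt (u w)) holomorphic_on cball 0 1"
    using nr unfolding u_def by (intro holomorphic_intros) auto
  have "measure (harmonic_measure z) {w \<in> sphere 0 1. d \<le> norm (w - p)} \<le> norm (csqrt (u z)) / sqrt (d / 2)"
  proof (rule harmonic_measure_markov[OF holomorphic_on_imp_continuous_on[OF hol] holomorphic_on_subset[OF hol] z])
    show "0 \<le> Re (csqrt (u w))" for w by (rule Re_csqrt_nonneg)
    fix w assume "w \<in> {w \<in> sphere 0 1. d \<le> norm (w - p)}"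
    then have w: "w \<in> cball 0 1" "d \<le> norm (1 - cnj p * w)"
      by (auto simp: norm_one_minus_cnj_eq_dist[OF p] norm_minus_commute)
    have "d \<le> norm (u w)"
      using norm_le_norm_add_of_real[OF Re_one_minus_cnj_nonneg[OF p w(1)], of \<delta>] w(2) \<delta> by (simp add: u_def)
    then have "sqrt (d / 2) \<le> sqrt (norm (u w) / 2)" by simp
    also have "\<dots> \<le> Re (csqrt (u w))" using Re_u[OF w(1)] by (intro Re_csqrt_ge) simp
    finally show "sqrt (d / 2) \<le> Re (csqrt (u w))" .
  qed (use d circle_sets_dist in auto)
  also have "\<dots> \<le> sqrt (2 * \<delta>) / sqrt (d / 2)"
  proof -
    have "norm (u z) \<le> norm (1 - cnj p * z) + \<delta>"
      unfolding u_def using norm_triangle_ineq[of "1 - cnj p * z" "of_real \<delta>"] \<delta> by simp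
    also have "\<dots> = 2 * \<delta>" by (simp add: norm_one_minus_cnj_eq_dist[OF p] \<delta>_def norm_minus_commute)
    finally show ?thesis using d by (intro divide_right_mono) (simp_all add: norm_csqrt)
  qed
  also have "\<dots> = sqrt (2\<^sup>2 * (\<delta> / d))"
    unfolding real_sqrt_divide[symmetric] by (simp add: field_simps)
  also have "\<dots> = 2 * sqrt (\<delta> / d)" by (simp only: real_sqrt_mult real_sqrt_abs abs_numeral)
  finally show ?thesis by (simp add: \<delta>_def)
qed

lemma harmonic_measure_near:
  assumes \<eta>: "0 < \<eta>"
  shows "measure (harmonic_measure z) {w \<in> sphere 0 1. norm (w - p) \<le> \<eta>} \<le> 2 * sqrt (\<eta> / norm (z - p))"
proof -
  \<comment> \<open>Here the shift is the radius of the small arc: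
    \<open>norm (u w) \<le> 2 * \<eta>\<close> there, so the inverse root is large on it, with real
    part at least \<open>1 / sqrt (2 * norm (u w)) \<ge> 1 / sqrt (4 * \<eta>)\<close>.\<close>
  define u where "u w = (1 - cnj p * w) + of_real \<eta>" for w
  have Re_u: "Re (u w) > 0" if "w \<in> cball 0 1" for w
    using Re_one_minus_cnj_nonneg[OF p that] \<eta> by (simp add: u_def)
  then have u0: "u w \<noteq> 0" if "w \<in> cball 0 1" for w
    using that by fastforce
  have nr: "u w \<notin> \<real>\<^sub>\<le>\<^sub>0" if "w \<in> cball 0 1" for w
    using Re_u that by (fastforce simp: complex_nonpos_Reals_iff)
  have hol: "(\<lambda>w. inverse (csqrt (u w))) holomorphic_on cball 0 1"
    using nr u0 unfolding u_def by (intro holomorphic_intros) auto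
  have Re_h: "Re (inverse (csqrt v)) = Re (csqrt v) / norm v" for v
  proof -
    have "Re (inverse (csqrt v)) = Re (csqrt v) / (norm (csqrt v))\<^sup>2"
      by (simp only: inverse_complex.sel cmod_power2)
    then show ?thesis by (simp add: norm_csqrt)
  qed
  have "measure (harmonic_measure z) {w \<in> sphere 0 1. norm (w - p) \<le> \<eta>}
    \<le> norm (inverse (csqrt (u z))) / (1 / sqrt (2\<^sup>2 * \<eta>))"
  proof (rule harmonic_measure_markov[OF holomorphic_on_imp_continuous_on[OF hol] holomorphic_on_subset[OF hol] z])
    show "0 \<le> Re (inverse (csqrt (u w)))" for w unfolding Re_h by (intro divide_nonneg_nonneg Re_csqrt_nonneg norm_ge_zero)
    fix w assume "w \<in> {w \<in> sphere 0 1. norm (w - p) \<le> \<eta>}"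
    then have w: "w \<in> cball 0 1" "norm (1 - cnj p * w) \<le> \<eta>"
      by (auto simp: norm_one_minus_cnj_eq_dist[OF p] norm_minus_commute)
    have "norm (u w) \<le> 2 * \<eta>"
      unfolding u_def using norm_triangle_ineq[of "1 - cnj p * w" "of_real \<eta>"] w(2) \<eta> by simp
    moreover have n0: "norm (u w) > 0" using u0[OF w(1)] by simp
    ultimately have "1 / sqrt (2\<^sup>2 * \<eta>) \<le> 1 / sqrt (2 * norm (u w))"
      using \<eta> by (intro divide_left_mono) (auto intro!: mult_pos_pos)
    also have "\<dots> = sqrt (norm (u w) / 2) / norm (u w)"
    proof -
      have "norm (u w) = sqrt (norm (u w)) * sqrt (norm (u w))" by simp
      then show ?thesis using n0 by (simp add: real_sqrt_divide real_sqrt_mult field_simps)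
    qed
    also have "\<dots> \<le> Re (inverse (csqrt (u w)))"
      unfolding Re_h using Re_u[OF w(1)] by (intro divide_right_mono Re_csqrt_ge) simp_all
    finally show "1 / sqrt (2\<^sup>2 * \<eta>) \<le> Re (inverse (csqrt (u w)))" .
  qed (use \<eta> circle_sets_dist in auto)
  also have "\<dots> = sqrt (2\<^sup>2 * \<eta>) / sqrt (norm (u z))"
    by (simp add: norm_inverse norm_csqrt divide_inverse mult.commute)
  also have "\<dots> \<le> sqrt (2\<^sup>2 * \<eta>) / sqrt (norm (z - p))"
  proof -
    have zb: "z \<in> cball 0 1" using z by auto
    have "norm (z - p) = norm (1 - cnj p * z)"
      by (simp add: norm_one_minus_cnj_eq_dist[OF p] norm_minus_commute)
    also have "\<dots> \<le> norm (u z)"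
      unfolding u_def using \<eta> by (intro norm_le_norm_add_of_real Re_one_minus_cnj_nonneg p zb) simp
    finally have "norm (z - p) \<le> norm (u z)" .
    moreover have "0 < norm (z - p)" using p z by auto
    ultimately show ?thesis using \<eta> by (intro divide_left_mono mult_pos_pos) auto
  qed
  also have "\<dots> = 2 * sqrt (\<eta> / norm (z - p))"
    unfolding real_sqrt_mult real_sqrt_divide by simp
  finally show ?thesis .
qed

end

section \<open>Boundary dynamics\<close>

text \<open>Replaces the partial radial extension by a total measurable self-map of the circle that
  agrees with it almost everywhere, so that image measures and iterates can be formed.\<close>

lemma inner_function_boundary_map:
  assumes f: "inner_function f"
  obtains F where "F \<in> measurable circle_measure circle_measure"
    and "AE \<zeta> in circle_measure. radial_extension f \<zeta> = Some (F \<zeta>)"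
proof -
  define s where "s n = 1 - inverse (real (Suc (Suc n)))" for n
  have s: "0 < s n" "s n < 1" for n
    unfolding s_def using radial_sequence(2) by blast+
  have sl: "filterlim s (at_left 1) sequentially"
    unfolding s_def by (rule radial_sequence(3))
  have cf: "continuous_on (ball 0 1) f"
    using f by (auto simp: inner_function_def intro: holomorphic_on_imp_continuous_on)
  define R where "R \<zeta> = lim (\<lambda>n. f (of_real (s n) * \<zeta>))" for \<zeta>
  \<comment> \<open>\<open>lim\<close> has an unspecified value where the sequence diverges. The
    default 1 keeps \<open>F\<close> on the circle everywhere and does not affect points with a
    unimodular radial limit.\<close>
  define F where "F \<zeta> = (if R \<zeta> \<in> sphere 0 1 then R \<zeta> else 1)" for \<zeta>
  have [measurable]: "(\<lambda>\<zeta>. f (of_real (s n) * \<zeta>)) \<in> borel_measurable circle_measure" for n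
    using s[of n]
    by (intro borel_measurable_circle refl continuous_on_compose2[OF cf]) (auto intro!: continuous_intros simp: norm_mult)
  have [measurable]: "R \<in> borel_measurable circle_measure"
    unfolding R_def by measurable
  have "F \<in> measurable circle_measure (restrict_space borel (sphere 0 1))"
    unfolding F_def by (intro measurable_restrict_space2) auto
  then have "F \<in> measurable circle_measure circle_measure"
    by (simp cong: measurable_cong_sets add: sets_circle_measure)
  moreover have "AE \<zeta> in circle_measure. radial_extension f \<zeta> = Some (F \<zeta>)"
  proof -
    have "AE \<zeta> in circle_measure. \<exists>w\<in>sphere 0 1. has_radial_limit f \<zeta> w"
      using f by (simp add: inner_function_def)
    then show ?thesis
    proof (rule AE_mp, intro AE_I2 impI)
      fix \<zeta> assume "\<zeta> \<in> space circle_measure" and "\<exists>w\<in>sphere 0 1. has_radial_limit f \<zeta> w"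
      then obtain w where w: "\<zeta> \<in> sphere 0 1" "w \<in> sphere 0 1" "has_radial_limit f \<zeta> w"
        by (auto simp: space_circle_measure)
      then have "(\<lambda>n. f (of_real (s n) * \<zeta>)) \<longlonglongrightarrow> w"
        unfolding has_radial_limit_def by (intro filterlim_compose[OF _ sl])
      then have "R \<zeta> = w" unfolding R_def by (rule limI)
      then show "radial_extension f \<zeta> = Some (F \<zeta>)"
        using w by (simp add: radial_extension_eq_Some_iff F_def)
    qed
  qed
  ultimately show thesis by (rule that)
qed

text \<open>Loewner's lemma, by comparing moments. The Poisson formula is applied to the dilates
  \<open>f (s w) ^ k\<close>, which are holomorphic on the closed disc; as \<open>s\<close> tends to
  1, dominated convergence gives \<open>f z ^ k\<close>, the \<open>k\<close>-th moment of the
  harmonic measure seen from \<open>f z\<close>.\<close>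

lemma distr_harmonic_measure:
  assumes f: "inner_function f" and F: "F \<in> measurable circle_measure circle_measure"
    and ext: "AE \<zeta> in circle_measure. radial_extension f \<zeta> = Some (F \<zeta>)" and z: "z \<in> ball 0 1"
  shows "distr (harmonic_measure z) circle_measure F = harmonic_measure (f z)"
proof (rule measure_eqI_moments)
  have holo: "f holomorphic_on ball 0 1" and im: "f ` ball 0 1 \<subseteq> ball 0 1"
    using f by (auto simp: inner_function_def)
  have fz: "f z \<in> ball 0 1" using im z by (auto simp: image_subset_iff)
  have F': "F \<in> measurable (harmonic_measure z) circle_measure"
    using F by (simp cong: measurable_cong_sets)
  show "finite_measure (distr (harmonic_measure z) circle_measure F)"
    by (intro finite_measure.finite_measure_distr finite_measure_harmonic_measure z F')
  show "finite_measure (harmonic_measure (f z))"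
    by (intro finite_measure_harmonic_measure fz)
  fix k :: nat
  define s where "s n = 1 - inverse (real (Suc (Suc n)))" for n
  have s: "s \<longlonglongrightarrow> 1" "0 < s n" "s n < 1" for n
    unfolding s_def using radial_sequence by blast+
  have sl: "filterlim s (at_left 1) sequentially"
    unfolding s_def by (rule radial_sequence(3))
  define g where "g n w = f (of_real (s n) * w) ^ k" for n w
  have sb: "of_real (s n) * w \<in> ball 0 1" if "w \<in> cball 0 1" for n and w :: complex
  proof -
    have "norm (of_real (s n) * w) \<le> s n"
      using that s(2,3)[of n] by (simp add: norm_mult mult_left_le)
    then show ?thesis using s(3)[of n] unfolding mem_ball_0 by linarith
  qed
  have hol: "g n holomorphic_on cball 0 1" for n
    unfolding g_def using sb
    by (intro holomorphic_intros holomorphic_on_compose_gen[unfolded o_def, OF _ holo]) auto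
  have cont: "continuous_on (sphere 0 1) (g n)" for n
    by (rule continuous_on_subset[OF holomorphic_on_imp_continuous_on[OF hol]]) auto
  have "(\<lambda>n. \<integral>w. g n w \<partial>harmonic_measure z) \<longlonglongrightarrow> (\<integral>w. F w ^ k \<partial>harmonic_measure z)"
  proof (rule integral_dominated_convergence[where w="\<lambda>_. 1"])
    have "F \<in> borel_measurable (harmonic_measure z)"
      using measurable_compose[OF F' borel_measurable_circle[OF refl, of "\<lambda>w. w"]] by simp
    then show "(\<lambda>w. F w ^ k) \<in> borel_measurable (harmonic_measure z)" by measurable
    show "g n \<in> borel_measurable (harmonic_measure z)" for n
      by (intro borel_measurable_circle cont) simp
    show "integrable (harmonic_measure z) (\<lambda>_. 1)"
      by (intro finite_measure.integrable_const finite_measure_harmonic_measure z)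
    show "AE w in harmonic_measure z. (\<lambda>n. g n w) \<longlonglongrightarrow> F w ^ k"
    proof (rule AE_mp[OF AE_harmonic_measureI[OF z ext]], intro AE_I2 impI)
      fix \<zeta> assume "radial_extension f \<zeta> = Some (F \<zeta>)"
      then have "has_radial_limit f \<zeta> (F \<zeta>)" by (simp add: radial_extension_eq_Some_iff)
      then have "(\<lambda>n. f (of_real (s n) * \<zeta>)) \<longlonglongrightarrow> F \<zeta>"
        unfolding has_radial_limit_def by (intro filterlim_compose[OF _ sl])
      then show "(\<lambda>n. g n \<zeta>) \<longlonglongrightarrow> F \<zeta> ^ k" unfolding g_def by (rule tendsto_power)
    qed
    show "AE w in harmonic_measure z. norm (g n w) \<le> 1" for n
    proof (rule AE_I2)
      fix w assume "w \<in> space (harmonic_measure z)"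
      then have "f (of_real (s n) * w) \<in> ball 0 1" using im sb[of w n] by (auto simp: image_subset_iff)
      then show "norm (g n w) \<le> 1" by (simp add: g_def norm_power power_le_one)
    qed
  qed
  moreover have "(\<integral>w. g n w \<partial>harmonic_measure z) = g n z" for n
    by (intro integral_harmonic_measure z holomorphic_on_imp_continuous_on hol holomorphic_on_subset[OF hol]) auto
  moreover have "(\<lambda>n. g n z) \<longlonglongrightarrow> f z ^ k"
  proof -
    have "(\<lambda>n. of_real (s n) * z) \<longlonglongrightarrow> of_real 1 * z" by (intro tendsto_intros s)
    moreover have "isCont f z"
      using holo z holomorphic_on_imp_continuous_on continuous_on_interior interior_ball by metis
    ultimately have "(\<lambda>n. f (of_real (s n) * z)) \<longlonglongrightarrow> f z"
      by (intro isCont_tendsto_compose[of z f]) auto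
    then show ?thesis unfolding g_def by (rule tendsto_power)
  qed
  ultimately have "(\<integral>w. F w ^ k \<partial>harmonic_measure z) = f z ^ k"
    by (auto intro: LIMSEQ_unique)
  moreover have "(\<integral>w. w ^ k \<partial>harmonic_measure (f z)) = f z ^ k"
    by (intro integral_harmonic_measure fz continuous_intros holomorphic_intros)
  moreover have "(\<integral>w. w ^ k \<partial>distr (harmonic_measure z) circle_measure F) = (\<integral>w. F w ^ k \<partial>harmonic_measure z)"
    by (intro integral_distr F' borel_measurable_circle refl continuous_intros)
  ultimately show "(\<integral>w. w ^ k \<partial>distr (harmonic_measure z) circle_measure F) = (\<integral>w. w ^ k \<partial>harmonic_measure (f z))"
    by simp
qed simp_all

theorem theorem1:
  fixes f :: "complex \<Rightarrow> complex" and p :: complex and \<alpha> \<epsilon> :: real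
  assumes "inner_function f"
    and "hyperbolic f"
    and "p \<in> sphere 0 1"
    and "denjoy_wolff_point f p"
    and "has_angular_derivative f p (complex_of_real \<alpha>)"
    and "0 < \<alpha>" and "\<alpha> < 1"
    and "0 < \<epsilon>" and "\<epsilon> < 1"
  shows "AE \<zeta> in circle_measure. \<exists>N::nat. \<forall>n\<ge>N.
           \<exists>w. radial_iterate f n \<zeta> = Some w \<and>
             w \<in> annulus p (\<alpha> powr ((1 + \<epsilon>) * real n)) (\<alpha> powr ((1 - \<epsilon>) * real n)) \<inter> sphere 0 1"
proof -
  note p = \<open>p \<in> sphere 0 1\<close> and \<alpha> = \<open>0 < \<alpha>\<close> \<open>\<alpha> < 1\<close>
  have holo: "f holomorphic_on ball 0 1" and im: "f ` ball 0 1 \<subseteq> ball 0 1"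
    using assms(1) by (auto simp: inner_function_def)
  obtain F where F [measurable]: "F \<in> measurable circle_measure circle_measure"
    and ext: "AE \<zeta> in circle_measure. radial_extension f \<zeta> = Some (F \<zeta>)"
    by (rule inner_function_boundary_map[OF assms(1)])
  define Z where "Z n = (f ^^ n) 0" for n
  have Zb: "Z n \<in> ball 0 1" for n
    by (induction n) (use im in \<open>auto simp: Z_def image_subset_iff\<close>)
  have Zp: "0 < norm (Z n - p)" for n using Zb[of n] p by auto
  have Fn [measurable]: "(F ^^ n) \<in> measurable circle_measure circle_measure" for n
    by (induction n) (auto intro: measurable_comp[OF _ F])
  have dist: "distr circle_measure circle_measure (F ^^ n) = harmonic_measure (Z n)" for n
  proof (induction n)
    case 0
    have "distr circle_measure circle_measure (\<lambda>x. x) = circle_measure"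
      by (rule distr_id2) simp
    then show ?case by (simp add: Z_def harmonic_measure_0 id_def)
  next
    case (Suc n)
    have "distr circle_measure circle_measure (F ^^ Suc n)
      = distr (distr circle_measure circle_measure (F ^^ n)) circle_measure F"
      by (simp add: distr_distr)
    also have "\<dots> = harmonic_measure (Z (Suc n))"
      unfolding Suc.IH using distr_harmonic_measure[OF assms(1) F ext Zb[of n]] by (simp add: Z_def)
    finally show ?case .
  qed
  \<comment> \<open>The image of the circle measure under \<open>F ^^ n\<close> has a density, so
    the preimage of the exceptional null set is null; hence almost every orbit avoids that set at
    all times.\<close>
  have "AE \<zeta> in circle_measure. radial_extension f ((F ^^ n) \<zeta>) = Some (F ((F ^^ n) \<zeta>))" for n
  proof (rule AE_distrD[OF Fn])
    show "AE \<zeta> in distr circle_measure circle_measure (F ^^ n). radial_extension f \<zeta> = Some (F \<zeta>)"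
      unfolding dist by (rule AE_harmonic_measureI[OF Zb ext])
  qed
  then have "AE \<zeta> in circle_measure. \<forall>n. radial_extension f ((F ^^ n) \<zeta>) = Some (F ((F ^^ n) \<zeta>))"
    by (simp add: AE_all_countable)
  then have iter: "AE \<zeta> in circle_measure. \<forall>n. radial_iterate f n \<zeta> = Some ((F ^^ n) \<zeta>)"
  proof (rule AE_mp, intro AE_I2 impI allI)
    fix \<zeta> n assume "\<forall>n. radial_extension f ((F ^^ n) \<zeta>) = Some (F ((F ^^ n) \<zeta>))"
    then show "radial_iterate f n \<zeta> = Some ((F ^^ n) \<zeta>)"
      by (induction n) (auto simp: map_comp_def)
  qed
  define d where "d n = \<alpha> powr ((1 - \<epsilon>) * real n)" for n
  define \<eta> where "\<eta> n = \<alpha> powr ((1 + \<epsilon>) * real n)" for n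
  have pos: "d n > 0" "\<eta> n > 0" for n using \<alpha> by (auto simp: d_def \<eta>_def)
  \<comment> \<open>The complement in the circle of the open annulus, hence the non-strict
    inequalities.\<close>
  define B where "B n = {w \<in> sphere 0 1. d n \<le> norm (w - p)} \<union> {w \<in> sphere 0 1. norm (w - p) \<le> \<eta> n}" for n
  have mB [measurable]: "B n \<in> sets circle_measure" for n
    unfolding B_def using circle_sets_dist by (intro sets.Un)
  define A where "A n = (F ^^ n) -` B n \<inter> space circle_measure" for n
  have mA: "A n \<in> sets circle_measure" for n
    unfolding A_def using Fn mB by (rule measurable_sets)
  have meas: "measure circle_measure (A n) = measure (harmonic_measure (Z n)) (B n)" for n
    unfolding A_def dist[symmetric] by (rule measure_distr[symmetric, OF Fn mB])
  \<comment> \<open>The orbit is located with \<open>\<epsilon> / 2\<close> while the radii use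
    \<open>\<epsilon>\<close>; the gap leaves a ratio
    \<open>\<alpha> powr (\<epsilon> / 2 * n)\<close>, and the square root in the tail bounds halves
    the exponent.\<close>
  define c where "c = \<alpha> powr (\<epsilon> / 4)"
  have c: "0 < c" "c < 1" using \<alpha> assms(8) by (auto simp: c_def powr_def mult_pos_neg)
  have half: "sqrt (\<alpha> powr (\<epsilon> / 2 * real n)) = c ^ n" for n
    using \<alpha> by (simp add: c_def powr_half_sqrt[symmetric] powr_powr powr_realpow[symmetric])
  have "\<forall>\<^sub>F n in sequentially. \<alpha> powr ((1 + \<epsilon> / 2) * real n) \<le> norm (Z n - p) \<and> norm (Z n - p) \<le> \<alpha> powr ((1 - \<epsilon> / 2) * real n)"
  proof (rule eventually_powr_bounds_of_ratio)
    show "0 < norm (Z n - p)" for n by (rule Zp)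
    show "(\<lambda>n. norm (Z (Suc n) - p) / norm (Z n - p)) \<longlonglongrightarrow> \<alpha>"
      unfolding Z_def by (intro orbit_ratio_tendsto holo im assms)
  qed (use assms in auto)
  then have "\<forall>\<^sub>F n in sequentially. norm (measure circle_measure (A n)) \<le> 4 * c ^ n"
  proof eventually_elim
    case (elim n)
    have "norm (Z n - p) / d n \<le> \<alpha> powr ((1 - \<epsilon> / 2) * real n) / d n"
      using elim pos(1)[of n] by (intro divide_right_mono) auto
    also have "\<dots> = \<alpha> powr (\<epsilon> / 2 * real n)"
      using \<alpha> by (simp add: d_def powr_diff[symmetric] algebra_simps)
    finally have "sqrt (norm (Z n - p) / d n) \<le> c ^ n"
      by (simp only: half[symmetric] real_sqrt_le_iff)
    then have far: "measure (harmonic_measure (Z n)) {w \<in> sphere 0 1. d n \<le> norm (w - p)} \<le> 2 * c ^ n"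
      using harmonic_measure_far[OF p Zb[of n] pos(1)[of n]] by linarith
    have "\<eta> n / norm (Z n - p) \<le> \<eta> n / \<alpha> powr ((1 + \<epsilon> / 2) * real n)"
      using elim pos(2)[of n] \<alpha> Zp[of n] by (intro divide_left_mono mult_pos_pos) auto
    also have "\<dots> = \<alpha> powr (\<epsilon> / 2 * real n)"
      using \<alpha> by (simp add: \<eta>_def powr_diff[symmetric] algebra_simps)
    finally have "sqrt (\<eta> n / norm (Z n - p)) \<le> c ^ n"
      by (simp only: half[symmetric] real_sqrt_le_iff)
    then have near: "measure (harmonic_measure (Z n)) {w \<in> sphere 0 1. norm (w - p) \<le> \<eta> n} \<le> 2 * c ^ n"
      using harmonic_measure_near[OF p Zb[of n] pos(2)[of n]] by linarith
    have "measure (harmonic_measure (Z n)) (B n) \<le> 2 * c ^ n + 2 * c ^ n"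
      unfolding B_def
      by (rule order_trans[OF measure_Un_le add_mono[OF far near]]) (simp_all only: circle_sets_dist sets_harmonic_measure)
    then show ?case by (simp add: meas)
  qed
  then have "summable (\<lambda>n. measure circle_measure (A n))"
    using c by (intro summable_comparison_test_ev[OF _ summable_mult[OF summable_geometric]]) auto
  then have "AE \<zeta> in circle_measure. \<forall>\<^sub>F n in sequentially. \<zeta> \<in> space circle_measure - A n"
    using finite_measure.emeasure_finite[OF finite_measure_circle_measure]
    by (intro borel_cantelli_AE1 mA) (auto simp: less_top)
  then show ?thesis
    using iter
  proof eventually_elim
    case (elim \<zeta>)
    from elim(1) obtain N where N: "\<And>n. n \<ge> N \<Longrightarrow> \<zeta> \<in> space circle_measure - A n"
      unfolding eventually_sequentially by blast
    show ?case
    proof (intro exI[of _ N] allI impI exI conjI)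
      fix n assume "N \<le> n"
      from N[OF this] have \<zeta>: "\<zeta> \<in> space circle_measure" "(F ^^ n) \<zeta> \<notin> B n" by (auto simp: A_def)
      have "(F ^^ n) \<zeta> \<in> sphere 0 1"
        using measurable_space[OF Fn \<zeta>(1)] by (simp add: space_circle_measure)
      then show "(F ^^ n) \<zeta> \<in> annulus p (\<alpha> powr ((1 + \<epsilon>) * real n)) (\<alpha> powr ((1 - \<epsilon>) * real n)) \<inter> sphere 0 1"
        using \<zeta>(2) by (auto simp: B_def annulus_def d_def \<eta>_def not_le)
      show "radial_iterate f n \<zeta> = Some ((F ^^ n) \<zeta>)" using elim(2) by blast
    qed
  qed
qed

end
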